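(* Let $Z$ be a real Hilbert space, let $\mathfrak{A}$ be a maximal dissipative (possibly set-valued) operator on $Z$ with domain $\mathcal{D}(\mathfrak{A})\subset Z$, and let $\mathcal{K}\subset Z$ be a closed and convex set with $\operatorname{int}(\mathcal{K})\neq\emptyset$ and $\mathcal{K}\subset\overline{\mathcal{D}(\mathfrak{A})}$. Define the operator $\mathfrak{A}^0_{\mathcal{K}}$ by $$\mathfrak{A}^0_{\mathcal{K}} z = \underset{w\in\Pi_{\mathcal{K}}(z,\mathfrak{A}z)}{\operatorname{arg\,min}}\ \|w\|,\qquad \mathcal{D}(\mathfrak{A}^0_{\mathcal{K}})=\mathcal{D}(\mathfrak{A})\cap\mathcal{K}.$$ Then: (i) The operator $\mathfrak{A}_{\mathcal{K}}=\mathfrak{A}-N_{\mathcal{K}}$, with domain $\mathcal{D}(\mathfrak{A}_{\mathcal{K}})=\mathcal{D}(\mathfrak{A}^0_{\mathcal{K}})$, is maximal dissipative, and for every $z\in\mathcal{D}(\mathfrak{A}_{\mathcal{K}})$, $\mathfrak{A}^0_{\mathcal{K}}z$ is the element of minimal norm in the set $\mathfrak{A}_{\mathcal{K}}z$. (ii) $\mathfrak{A}^0_{\mathcal{K}}$ is the strong generator of a strongly continuous semigroup $\mathfrak{T}^{\mathcal{K}}=(\mathfrak{T}^{\mathcal{K}}_t)_{t\geq 0}$ of (possibly nonlinear) contractions on $\mathcal{K}$. (iii) For every $z_0\in\mathcal{D}(\mathfrak{A}^0_{\mathcal{K}})$, the function $z:[0,\infty)\to Z$ defined by $z(t)=\mathfrak{T}^{\mathcal{K}}_t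 z_0$ is Lipschitz continuous and right differentiable, $$z(t)\in\mathcal{D}(\mathfrak{A}^0_{\mathcal{K}}),\qquad \frac{d^+}{dt}z(t)=\mathfrak{A}^0_{\mathcal{K}}z(t)\qquad\text{for all } t\geq 0,$$ and $t\mapsto\mathfrak{A}^0_{\mathcal{K}}z(t)$ is right continuous at every $t\geq 0$. (iv) For every $z_0\in\mathcal{D}(\mathfrak{A}^0_{\mathcal{K}})$, the function $z:[0,\infty)\to Z$ defined by $z(t)=\mathfrak{T}^{\mathcal{K}}_t z_0$ is the unique solution of the projected differential inclusion $$\frac{d^+}{dt}z(t)\in\Pi_{\mathcal{K}}(z(t),\mathfrak{A}z(t))\quad(t\geq 0),\qquad z(0)=z_0 .$$
   Context: Let $Z$ be a real Hilbert space. Set-valued operators. A (possibly set-valued) operator $\mathcal{N}$ on $Z$ assigns to each $w$ in its domain $\mathcal{D}(\mathcal{N})\subset Z$ a nonempty subset $\mathcal{N}(w)\subset Z$; set $\mathcal{N}(w)=\emptyset$ for $w\notin\mathcal{D}(\mathcal{N})$. It is monotone if $\langle g_1-g_2,w_1-w_2\rangle\geq 0$ for all $w_1,w_2\in\mathcal{D}(\mathcal{N})$, $g_1\in\mathcal{N}(w_1)$, $g_2\in\mathcal{N}(w_2)$; it is maximal monotone if it has no proper monotone extension (in the sense of graphs in $Z\times Z$). $\mathcal{N}$ is (maximal) dissipative if $-\mathcal{N}$ is (maximal) monotone. Sums and differences of set-valued operators are pointwise Minkowski sums and differences, defined on the intersection of the domains. Cones and projections. Let $\mathcal{K}\subset Z$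 be closed and convex. For $z\in\mathcal{K}$, the tangent cone $T_{\mathcal{K}}(z)$ is the closure of the set of all vectors $\lambda(x-z)$ with $x\in\mathcal{K}$, $\lambda>0$. The normal cone is $N_{\mathcal{K}}(z)=\{p\in Z : \langle p,z-q\rangle\geq 0\ \ \forall q\in\mathcal{K}\}$ for $z\in\mathcal{K}$ and $N_{\mathcal{K}}(z)=\emptyset$ for $z\notin\mathcal{K}$. For $z\in\mathcal{K}$ and $v\in Z$, $\Pi_{\mathcal{K}}(z,v)$ is the orthogonal (nearest point) projection of $v$ onto the closed convex cone $T_{\mathcal{K}}(z)$, and for a set $S\subset Z$, $\Pi_{\mathcal{K}}(z,S)=\{\Pi_{\mathcal{K}}(z,s) : s\in S\}$. For $z\notin\mathcal{K}$, $\Pi_{\mathcal{K}}(z,\cdot)=\emptyset$. The notation $\operatorname{arg\,min}_{w\in S}\|w\|$ denotes the element of $S$ of minimal norm. Semigroups. A strongly continuous semigroup of (possibly nonlinear) operators on a closed set $\mathcal{K}\subset Z$ is a family $\mathfrak{T}=(\mathfrak{T}_t)_{t\geq 0}$ of maps $\mathfrak{T}_t:\mathcal{K}\to\mathcal{K}$ with $\mathfrak{T}_0=I$, $\mathfrak{T}_{t+s}=\mathfrak{T}_t\mathfrak{T}_s$, and $t\mapsto\mathfrak{T}_tz$ continuous on $[0,\infty)$ for every $z\in\mathcal{K}$. It is a semigroup of contractions if $\|\mathfrak{T}_tz_1-\mathfrak{T}_tz_2\|\leq\|z_1-z_2\|$ for all $z_1,z_2\in\mathcal{K}$, $t\geq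 0$. Its strong generator is the single-valued operator $z\mapsto\lim_{t\to 0,\,t>0}\frac1t[\mathfrak{T}_tz-z]$, whose domain is the set of all $z\in\mathcal{K}$ for which this limit exists in $Z$. $\frac{d^+}{dt}$ denotes the right derivative. Solution. A solution of the projected differential inclusion $\frac{d^+}{dt}z(t)\in\Pi_{\mathcal{K}}(z(t),\mathfrak{A}z(t))$, $z(0)=z_0\in\mathcal{D}(\mathfrak{A})\cap\mathcal{K}$, is a Lipschitz continuous and right differentiable function $z:[0,\infty)\to\mathcal{D}(\mathfrak{A})\cap\mathcal{K}$ which satisfies the inclusion for all $t\geq 0$ and $z(0)=z_0$. *)

theory Defs
  imports "HOL-Analysis.Analysis"
begin

(* Set-valued operators on 'a are functions into 'a set; the domain is where the value is nonempty. *)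

definition op_domain :: "('a \<Rightarrow> 'a set) \<Rightarrow> 'a set" where
  "op_domain N = {w. N w \<noteq> {}}"

definition op_graph :: "('a \<Rightarrow> 'a set) \<Rightarrow> ('a \<times> 'a) set" where
  "op_graph N = {(w, g). g \<in> N w}"

definition monotone_operator :: "('a::real_inner \<Rightarrow> 'a set) \<Rightarrow> bool" where
  "monotone_operator N \<longleftrightarrow>
     (\<forall>w1\<in>op_domain N. \<forall>w2\<in>op_domain N. \<forall>g1\<in>N w1. \<forall>g2\<in>N w2. inner (g1 - g2) (w1 - w2) \<ge> 0)"

definition maximal_monotone :: "('a::real_inner \<Rightarrow> 'a set) \<Rightarrow> bool" where
  "maximal_monotone N \<longleftrightarrow>
     monotone_operator N \<and> \<not> (\<exists>M. monotone_operator M \<and> op_graph N \<subset> op_graph M)"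

definition maximal_dissipative :: "('a::real_inner \<Rightarrow> 'a set) \<Rightarrow> bool" where
  "maximal_dissipative N \<longleftrightarrow> maximal_monotone (\<lambda>w. uminus ` N w)"

(* The Minkowski difference with an empty set is empty, so the domain is the intersection. *)
definition op_diff :: "('a::real_inner \<Rightarrow> 'a set) \<Rightarrow> ('a \<Rightarrow> 'a set) \<Rightarrow> 'a \<Rightarrow> 'a set" where
  "op_diff M N z = {a - b | a b. a \<in> M z \<and> b \<in> N z}"

definition tangent_cone :: "'a::real_inner set \<Rightarrow> 'a \<Rightarrow> 'a set" where
  "tangent_cone K z = closure {l *\<^sub>R (x - z) | l x. l > 0 \<and> x \<in> K}"

definition normal_cone :: "'a::real_inner set \<Rightarrow> 'a \<Rightarrow> 'a set" where
  "normal_cone K z = (if z \<in> K then {p. \<forall>q\<in>K. inner p (z - q) \<ge> 0} else {})"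

(* The library's closest_point has sort heine_borel, which excludes infinite dimensions. *)
definition nearest_point :: "'a::metric_space set \<Rightarrow> 'a \<Rightarrow> 'a" where
  "nearest_point S v = arg_min_on (dist v) S"

definition cone_projection :: "'a::real_inner set \<Rightarrow> 'a \<Rightarrow> 'a set \<Rightarrow> 'a set" where
  "cone_projection K z S = (if z \<in> K then nearest_point (tangent_cone K z) ` S else {})"

(* w is THE element of minimal norm of S: minimality is strict. *)
definition is_min_norm_element :: "'a::real_normed_vector set \<Rightarrow> 'a \<Rightarrow> bool" where
  "is_min_norm_element S w \<longleftrightarrow> w \<in> S \<and> (\<forall>v\<in>S. v \<noteq> w \<longrightarrow> norm w < norm v)"

(* Values are meaningful only for z in op_domain A \<inter> K, the domain of the operator. *)
definition minimal_projected :: "('a::real_inner \<Rightarrow> 'a set) \<Rightarrow> 'a set \<Rightarrow> 'a \<Rightarrow> 'a" where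
  "minimal_projected A K z = arg_min_on norm (cone_projection K z (A z))"

(* Only the values T t z with t \<ge> 0 and z in K matter. *)
definition contraction_semigroup_on :: "'a::real_inner set \<Rightarrow> (real \<Rightarrow> 'a \<Rightarrow> 'a) \<Rightarrow> bool" where
  "contraction_semigroup_on K T \<longleftrightarrow>
     (\<forall>t\<ge>0. \<forall>z\<in>K. T t z \<in> K) \<and>
     (\<forall>z\<in>K. T 0 z = z) \<and>
     (\<forall>t\<ge>0. \<forall>s\<ge>0. \<forall>z\<in>K. T (t + s) z = T t (T s z)) \<and>
     (\<forall>z\<in>K. continuous_on {0..} (\<lambda>t. T t z)) \<and>
     (\<forall>t\<ge>0. \<forall>z1\<in>K. \<forall>z2\<in>K. norm (T t z1 - T t z2) \<le> norm (z1 - z2))"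

(* The single-valued operator G with domain D is the strong generator of T. *)
definition is_strong_generator ::
  "'a::real_inner set \<Rightarrow> (real \<Rightarrow> 'a \<Rightarrow> 'a) \<Rightarrow> 'a set \<Rightarrow> ('a \<Rightarrow> 'a) \<Rightarrow> bool" where
  "is_strong_generator K T D G \<longleftrightarrow>
     D = {z\<in>K. \<exists>w. ((\<lambda>t. (1 / t) *\<^sub>R (T t z - z)) \<longlongrightarrow> w) (at_right 0)} \<and>
     (\<forall>z\<in>D. ((\<lambda>t. (1 / t) *\<^sub>R (T t z - z)) \<longlongrightarrow> G z) (at_right 0))"

(* A function on [0,\<infinity>) is a function on the reals of which only the values at t \<ge> 0 matter. *)
definition pdi_solution ::
  "('a::real_inner \<Rightarrow> 'a set) \<Rightarrow> 'a set \<Rightarrow> 'a \<Rightarrow> (real \<Rightarrow> 'a) \<Rightarrow> bool" where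
  "pdi_solution A K z0 z \<longleftrightarrow>
     (\<exists>L. L-lipschitz_on {0..} z) \<and>
     (\<forall>t\<ge>0. z t \<in> op_domain A \<inter> K) \<and>
     (\<forall>t\<ge>0. \<exists>d\<in>cone_projection K (z t) (A (z t)). (z has_vector_derivative d) (at_right t)) \<and>
     z 0 = z0"

end

theory Submission
  imports Defs
begin

text \<open>
  Write \<open>N\<close> for the normal cone of \<open>K\<close>. The tangent and the normal cone at a point are polar to each other,
  so projecting \<open>v\<close> onto the tangent cone subtracts from \<open>v\<close> a normal vector, namely the one that makes the
  result shortest (\<open>tangent_projection_moreau\<close>). Consequently the projected velocities form a subset of
  \<open>A z - N z\<close> containing its element of minimal norm, and the projected inclusion becomes a question about the
  monotone operator \<open>M = - (A - N)\<close>. Two things remain: \<open>M\<close> is maximal, and every maximal monotone operator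
  generates a contraction semigroup with the stated regularity. Uniqueness is immediate, because the
  squared distance of two solutions has a nonpositive right derivative (\<open>pdi_solution_unique\<close>).

  All limits are strong. Two devices make weak compactness superfluous. The first is an intersection
  property of bounded closed convex sets, proved with elements of minimal norm
  (\<open>closed_convex_finite_intersection_property\<close>). Together with a minimisation over the convex hull of finitely
  many points it gives Minty's theorem (\<open>maximal_monotone_range\<close>), and thus resolvents and Yosida
  approximations. The second is \<open>convergent_of_antitone_weights\<close>: bounded families satisfying a certain
  quadratic inequality, as Yosida approximations do, converge because their norms are monotone.

  For maximality of \<open>M\<close>, the normal cone is replaced by the penalty \<open>(I - P) / l\<close>, with \<open>P\<close> the nearest-point map of
  \<open>K\<close>. A ball inside \<open>K\<close> around a point of the domain of \<open>A\<close> bounds the penalty terms, and the second device lets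
  \<open>l\<close> tend to zero (\<open>maximal_monotone_add_normal_cone\<close>).

  The semigroup is the limit of implicit Euler schemes with dyadic steps. Comparing a step with two steps of
  half the length (\<open>step_halving\<close>) bounds the difference of consecutive approximations by a geometric sequence,
  so no differential equation has to be solved. The limit satisfies an evolution inequality against
  every point of the graph (\<open>semigroup_evolution_inequality\<close>). Tested against the Yosida approximations
  it identifies the right derivative as minus the minimal section, and with maximality it shows that an
  orbit starting outside the domain has no right derivative at time zero.
\<close>

section \<open>Closed convex sets in a Hilbert space\<close>

lemma power2_norm_add:
  fixes x y :: "'a::real_inner"
  shows "(norm (x + y))\<^sup>2 = (norm x)\<^sup>2 + 2 * inner x y + (norm y)\<^sup>2"
  by (simp add: power2_norm_eq_inner inner_simps inner_commute)

lemma power2_norm_diff: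
  fixes x y :: "'a::real_inner"
  shows "(norm (x - y))\<^sup>2 = (norm x)\<^sup>2 - 2 * inner x y + (norm y)\<^sup>2"
  by (simp add: power2_norm_eq_inner inner_simps inner_commute)

text \<open>
  Dividing by \<open>t\<close> and letting \<open>t \<rightarrow> 0\<close>: the first-order condition at a minimiser over a
  segment, used wherever a quadratic functional is minimised over a convex set.
\<close>

lemma linear_le_quadratic_imp_nonneg:
  fixes a b :: real
  assumes "\<And>t. 0 < t \<Longrightarrow> t \<le> 1 \<Longrightarrow> 0 \<le> t * a + t\<^sup>2 * b"
  shows "0 \<le> a"
proof (rule ccontr)
  assume "\<not> 0 \<le> a"
  define t where "t = min 1 (- a / (2 * (\<bar>b\<bar> + 1)))"
  have t: "0 < t" "t \<le> 1" using \<open>\<not> 0 \<le> a\<close> by (auto simp: t_def field_simps)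
  have "t \<le> - a / (2 * (\<bar>b\<bar> + 1))" by (simp add: t_def)
  then have "t * (\<bar>b\<bar> + 1) \<le> - a / 2" by (simp add: field_simps)
  moreover have "t * b \<le> t * (\<bar>b\<bar> + 1)" using t by (intro mult_left_mono) auto
  ultimately have "a + t * b < 0" using \<open>\<not> 0 \<le> a\<close> by linarith
  then have "t * (a + t * b) < 0" using t by (simp add: mult_pos_neg)
  with assms[OF t] show False by (simp add: algebra_simps power2_eq_square)
qed

lemma Cauchy_if_inverse_Suc_bound:
  fixes x :: "nat \<Rightarrow> 'a::metric_space"
  assumes "\<And>m n. dist (x m) (x n) \<le> inverse (real (Suc m)) + inverse (real (Suc n))"
  shows "Cauchy x"
proof (rule metric_CauchyI)
  fix e :: real assume "0 < e"
  then obtain N where N: "inverse (real (Suc N)) < e / 2"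
    using reals_Archimedean[of "e / 2"] by auto
  have "dist (x m) (x n) < e" if "N \<le> m" "N \<le> n" for m n
  proof -
    have "inverse (real (Suc m)) \<le> inverse (real (Suc N))" "inverse (real (Suc n)) \<le> inverse (real (Suc N))"
      using that by (auto simp: field_simps)
    then show ?thesis using assms[of m n] N by linarith
  qed
  then show "\<exists>N. \<forall>m\<ge>N. \<forall>n\<ge>N. dist (x m) (x n) < e" by blast
qed

text \<open>
  The parallelogram law: the midpoint of two almost minimal elements of a convex set is still in
  the set, so the two elements are close. Completeness then replaces compactness in what follows.
\<close>

lemma convex_midpoint_norm:
  fixes C :: "'a::real_inner set"
  assumes "convex C" "x \<in> C" "y \<in> C" "\<And>z. z \<in> C \<Longrightarrow> s \<le> (norm z)\<^sup>2"
    and "(norm x)\<^sup>2 \<le> s + a" "(norm y)\<^sup>2 \<le> s + b"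
  shows "(norm (x - y))\<^sup>2 \<le> 2 * a + 2 * b"
proof -
  have "(1/2) *\<^sub>R x + (1/2) *\<^sub>R y \<in> C" using assms by (intro convexD) auto
  then have "(1/2) *\<^sub>R (x + y) \<in> C" by (simp add: scaleR_add_right)
  then have "s \<le> (norm ((1/2) *\<^sub>R (x + y)))\<^sup>2" using assms(4) by blast
  then have "4 * s \<le> (norm (x + y))\<^sup>2" by (simp add: power_mult_distrib power2_eq_square)
  then show ?thesis using assms(5,6) power2_norm_add[of x y] power2_norm_diff[of x y] by linarith
qed

lemma min_norm_variational:
  fixes C :: "'a::real_inner set"
  assumes "convex C" "x \<in> C" "\<And>y. y \<in> C \<Longrightarrow> norm x \<le> norm y" "y \<in> C"
  shows "0 \<le> inner x (y - x)"
proof -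
  have "0 \<le> t * (2 * inner x (y - x)) + t\<^sup>2 * (norm (y - x))\<^sup>2" if "0 < t" "t \<le> 1" for t
  proof -
    have "(1 - t) *\<^sub>R x + t *\<^sub>R y \<in> C" using assms that by (intro convexD) auto
    then have "x + t *\<^sub>R (y - x) \<in> C" by (simp add: algebra_simps)
    then have "(norm x)\<^sup>2 \<le> (norm (x + t *\<^sub>R (y - x)))\<^sup>2" using assms by (intro power_mono) auto
    then show ?thesis
      unfolding power2_norm_add by (simp add: power_mult_distrib)
  qed
  from linear_le_quadratic_imp_nonneg[OF this] show ?thesis by simp
qed

lemma min_norm_exists:
  fixes C :: "'a::{real_inner, complete_space} set"
  assumes "closed C" "convex C" "C \<noteq> {}"
  obtains x where "x \<in> C" "\<And>y. y \<in> C \<Longrightarrow> norm x \<le> norm y"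
proof -
  define s where "s = Inf ((\<lambda>x. (norm x)\<^sup>2) ` C)"
  have s: "s \<le> (norm z)\<^sup>2" if "z \<in> C" for z
    unfolding s_def using that by (intro cInf_lower bdd_belowI[of _ 0]) auto
  have "\<exists>x\<in>C. (norm x)\<^sup>2 \<le> s + (inverse (real (Suc n)))\<^sup>2 / 2" for n
  proof -
    have "s < s + (inverse (real (Suc n)))\<^sup>2 / 2" by simp
    then have "\<exists>r\<in>(\<lambda>x. (norm x)\<^sup>2) ` C. r < s + (inverse (real (Suc n)))\<^sup>2 / 2"
      unfolding s_def using assms by (intro cInf_lessD) auto
    then show ?thesis by (auto intro: less_imp_le)
  qed
  then obtain x where x: "\<And>n. x n \<in> C" "\<And>n. (norm (x n))\<^sup>2 \<le> s + (inverse (real (Suc n)))\<^sup>2 / 2"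
    by metis
  have "dist (x m) (x n) \<le> inverse (real (Suc m)) + inverse (real (Suc n))" for m n
  proof -
    have "(norm (x m - x n))\<^sup>2 \<le> (inverse (real (Suc m)))\<^sup>2 + (inverse (real (Suc n)))\<^sup>2"
      using convex_midpoint_norm[OF assms(2) x(1) x(1) s x(2) x(2)] by simp
    also have "\<dots> \<le> (inverse (real (Suc m)) + inverse (real (Suc n)))\<^sup>2"
      by (simp add: power2_sum)
    finally show ?thesis unfolding dist_norm by (rule power2_le_imp_le) simp
  qed
  then have "convergent x" by (intro Cauchy_convergent Cauchy_if_inverse_Suc_bound)
  then obtain l where l: "x \<longlonglongrightarrow> l" by (auto simp: convergent_def)
  have "l \<in> C" using closed_sequentially[OF assms(1)] x(1) l by blast
  moreover have "norm l \<le> norm y" if "y \<in> C" for y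
  proof -
    have "(\<lambda>n. s + (inverse (real (Suc n)))\<^sup>2 / 2) \<longlonglongrightarrow> s + 0\<^sup>2 / 2"
      by (intro tendsto_intros LIMSEQ_inverse_real_of_nat) simp
    moreover have "(\<lambda>n. (norm (x n))\<^sup>2) \<longlonglongrightarrow> (norm l)\<^sup>2" by (intro tendsto_intros l)
    ultimately have "(norm l)\<^sup>2 \<le> s + 0\<^sup>2 / 2" using x(2) by (intro LIMSEQ_le) auto
    also have "\<dots> \<le> (norm y)\<^sup>2" using s that by simp
    finally show ?thesis by (rule power2_le_imp_le) simp
  qed
  ultimately show thesis using that by blast
qed

lemma is_min_norm_elementI:
  fixes C :: "'a::real_inner set"
  assumes "convex C" "x \<in> C" "\<And>y. y \<in> C \<Longrightarrow> norm x \<le> norm y"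
  shows "is_min_norm_element C x"
proof -
  have "norm x < norm y" if "y \<in> C" "y \<noteq> x" for y
  proof -
    have "0 \<le> inner x (y - x)" by (rule min_norm_variational[OF assms that(1)])
    moreover have "(norm y)\<^sup>2 = (norm x)\<^sup>2 + 2 * inner x (y - x) + (norm (y - x))\<^sup>2"
      using power2_norm_add[of x "y - x"] by simp
    moreover have "0 < (norm (y - x))\<^sup>2" using that by simp
    ultimately have "(norm x)\<^sup>2 < (norm y)\<^sup>2" by linarith
    then show ?thesis by (rule power2_less_imp_less) simp
  qed
  then show ?thesis using assms by (simp add: is_min_norm_element_def)
qed

lemma nearest_point_props:
  fixes S :: "'a::{real_inner, complete_space} set"
  assumes "closed S" "convex S" "S \<noteq> {}"
  shows nearest_point_mem: "nearest_point S v \<in> S"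
    and nearest_point_variational: "\<And>y. y \<in> S \<Longrightarrow> inner (v - nearest_point S v) (y - nearest_point S v) \<le> 0"
proof -
  let ?C = "(\<lambda>y. - v + y) ` S"
  have C: "closed ?C" "convex ?C" "?C \<noteq> {}"
    using closed_translation[OF assms(1), of "- v"] convex_translation[OF assms(2), of "- v"] assms(3)
    by simp_all
  from min_norm_exists[OF C] obtain x where x: "x \<in> ?C" "\<And>y. y \<in> ?C \<Longrightarrow> norm x \<le> norm y" by blast
  then obtain p where p: "p \<in> S" "x = - v + p" by blast
  have "dist v p \<le> dist v y" if "y \<in> S" for y
    using x(2)[of "- v + y"] that p by (auto simp: dist_norm norm_minus_commute)
  then have "is_arg_min (dist v) (\<lambda>y. y \<in> S) p" using p by (auto simp: is_arg_min_linorder)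
  then have "is_arg_min (dist v) (\<lambda>y. y \<in> S) (nearest_point S v)"
    unfolding nearest_point_def arg_min_on_def arg_min_def by (rule someI)
  then have n: "nearest_point S v \<in> S" "\<And>y. y \<in> S \<Longrightarrow> dist v (nearest_point S v) \<le> dist v y"
    by (auto simp: is_arg_min_linorder)
  then show "nearest_point S v \<in> S" by blast
  show "inner (v - nearest_point S v) (y - nearest_point S v) \<le> 0" if "y \<in> S" for y
  proof -
    have "0 \<le> inner (- v + nearest_point S v) ((- v + y) - (- v + nearest_point S v))"
      using n that by (intro min_norm_variational[OF C(2)]) (auto simp: dist_norm norm_minus_commute)
    then show ?thesis by (simp add: inner_simps)
  qed
qed

lemma nearest_point_nonexpansive:
  fixes S :: "'a::{real_inner, complete_space} set"
  assumes "closed S" "convex S" "S \<noteq> {}"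
  shows "norm (nearest_point S u - nearest_point S v) \<le> norm (u - v)"
proof -
  let ?p = "nearest_point S u" and ?q = "nearest_point S v"
  have "inner (u - ?p) (?q - ?p) \<le> 0" "inner (v - ?q) (?p - ?q) \<le> 0"
    using nearest_point_props[OF assms] by blast+
  then have "(norm (?p - ?q))\<^sup>2 \<le> inner (u - v) (?p - ?q)"
    by (simp add: power2_norm_eq_inner inner_simps inner_commute)
  also have "\<dots> \<le> norm (u - v) * norm (?p - ?q)" by (rule norm_cauchy_schwarz)
  finally show ?thesis
    by (cases "norm (?p - ?q) = 0") (auto simp: power2_eq_square)
qed

text \<open>
  A substitute for weak compactness of bounded closed convex sets, by strong convergence alone.
  The elements of minimal norm of the finite intersections have norms bounded by the bound of
  \<open>C0\<close>; along finite subfamilies whose minimal norms approach the supremum \<open>s\<close>, these elements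
  form a Cauchy sequence, because enlarging a subfamily from \<open>G\<close> to \<open>H\<close> moves the minimal
  element by at most the square root of the increase of the squared norm. Adding one further
  member \<open>C\<close> to the subfamilies does not change the limit, so the limit lies in every \<open>C\<close>.
\<close>

lemma closed_convex_finite_intersection_property:
  fixes F :: "'a::{real_inner, complete_space} set set"
  assumes closed: "\<And>C. C \<in> F \<Longrightarrow> closed C" and convex: "\<And>C. C \<in> F \<Longrightarrow> convex C"
    and C0: "C0 \<in> F" "bounded C0"
    and fip: "\<And>G. finite G \<Longrightarrow> G \<subseteq> F \<Longrightarrow> \<Inter>G \<noteq> {}"
  shows "\<Inter>F \<noteq> {}"
proof -
  \<comment> \<open>Only subfamilies containing the bounded set are used, so that the minimal norms are bounded.\<close>
  define adm where "adm G \<longleftrightarrow> finite G \<and> G \<subseteq> F \<and> C0 \<in> G" for G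
  define mn where "mn G x \<longleftrightarrow> x \<in> \<Inter>G \<and> (\<forall>y\<in>\<Inter>G. norm x \<le> norm y)" for G and x :: 'a
  have ex: "\<exists>x. mn G x" if "adm G" for G
  proof -
    have "closed (\<Inter>G)" "convex (\<Inter>G)" "\<Inter>G \<noteq> {}"
      using that closed convex fip by (auto simp: adm_def intro!: closed_Inter convex_Inter)
    from min_norm_exists[OF this] show ?thesis unfolding mn_def by metis
  qed
  have close: "(norm (y - x))\<^sup>2 \<le> (norm y)\<^sup>2 - (norm x)\<^sup>2"
    if "adm G" "G \<subseteq> H" "mn G x" "mn H y" for G H x y
  proof -
    have "y \<in> \<Inter>G" using that by (auto simp: mn_def)
    moreover have "convex (\<Inter>G)" using that convex by (auto simp: adm_def intro!: convex_Inter)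
    ultimately have "0 \<le> inner x (y - x)"
      using that min_norm_variational[of "\<Inter>G" x y] by (auto simp: mn_def)
    moreover have "(norm y)\<^sup>2 = (norm x)\<^sup>2 + 2 * inner x (y - x) + (norm (y - x))\<^sup>2"
      using power2_norm_add[of x "y - x"] by simp
    ultimately show ?thesis by linarith
  qed
  obtain b where b: "\<And>x. x \<in> C0 \<Longrightarrow> norm x \<le> b" using C0 by (auto simp: bounded_iff)
  define V where "V = {(norm x)\<^sup>2 |G x. adm G \<and> mn G x}"
  have "V \<noteq> {}" using ex[of "{C0}"] C0 by (auto simp: V_def adm_def)
  have bdd: "bdd_above V"
  proof (rule bdd_aboveI)
    fix r assume "r \<in> V"
    then obtain G x where "adm G" "mn G x" "r = (norm x)\<^sup>2" by (auto simp: V_def)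
    then show "r \<le> b\<^sup>2" using b[of x] by (auto simp: adm_def mn_def intro!: power_mono)
  qed
  define s where "s = Sup V"
  have le_s: "(norm x)\<^sup>2 \<le> s" if "adm G" "mn G x" for G x
    unfolding s_def using that bdd by (intro cSup_upper) (auto simp: V_def)
  have "\<exists>G x. adm G \<and> mn G x \<and> s - (inverse (real (Suc n)))\<^sup>2 < (norm x)\<^sup>2" for n
  proof -
    have "s - (inverse (real (Suc n)))\<^sup>2 < s" by simp
    then have "\<exists>r\<in>V. s - (inverse (real (Suc n)))\<^sup>2 < r"
      unfolding s_def using \<open>V \<noteq> {}\<close> by (rule less_cSupD[rotated])
    then show ?thesis by (auto simp: V_def)
  qed
  then obtain G x where Gx: "\<And>n. adm (G n)" "\<And>n. mn (G n) (x n)"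
    "\<And>n. s - (inverse (real (Suc n)))\<^sup>2 < (norm (x n))\<^sup>2" by metis
  have near: "norm (y - x n) \<le> inverse (real (Suc n))" if "adm H" "G n \<subseteq> H" "mn H y" for H y n
  proof -
    have "(norm (y - x n))\<^sup>2 \<le> (inverse (real (Suc n)))\<^sup>2"
      using close[OF Gx(1) that(2) Gx(2) that(3)] le_s[OF that(1,3)] Gx(3)[of n] by linarith
    then show ?thesis by (rule power2_le_imp_le) simp
  qed
  have "dist (x m) (x n) \<le> inverse (real (Suc m)) + inverse (real (Suc n))" for m n
  proof -
    have a: "adm (G m \<union> G n)" using Gx(1) by (auto simp: adm_def)
    then obtain y where y: "mn (G m \<union> G n) y" using ex by blast
    have "norm (x m - x n) \<le> norm (y - x m) + norm (y - x n)"
      by (metis dist_commute dist_norm dist_triangle)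
    then show ?thesis using near[OF a _ y, of m] near[OF a _ y, of n] by (simp add: dist_norm)
  qed
  then have "convergent x" by (intro Cauchy_convergent Cauchy_if_inverse_Suc_bound)
  then obtain l where l: "x \<longlonglongrightarrow> l" by (auto simp: convergent_def)
  have "l \<in> C" if C: "C \<in> F" for C
  proof -
    have a: "adm (insert C (G n))" for n using Gx(1)[of n] C by (auto simp: adm_def)
    then have "\<forall>n. \<exists>y. mn (insert C (G n)) y" using ex by blast
    then obtain y where y: "\<And>n. mn (insert C (G n)) (y n)" by metis
    have "norm (y n - x n) \<le> inverse (real (Suc n))" for n
      using near[OF a _ y, of n] by blast
    then have "(\<lambda>n. y n - x n) \<longlonglongrightarrow> 0"
      by (intro Lim_null_comparison[OF _ LIMSEQ_inverse_real_of_nat]) auto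
    from tendsto_add[OF this l] have "y \<longlonglongrightarrow> l" by simp
    moreover have "y n \<in> C" for n using y[of n] by (auto simp: mn_def)
    ultimately show ?thesis using closed_sequentially[OF closed[OF C]] by blast
  qed
  then show ?thesis by blast
qed

section \<open>Maximal monotone operators: Minty's theorem, resolvents and the minimal section\<close>

lemma mem_op_domain: "y \<in> N x \<Longrightarrow> x \<in> op_domain N"
  by (auto simp: op_domain_def)

lemma monotone_operator_iff:
  "monotone_operator M \<longleftrightarrow> (\<forall>x y w g. y \<in> M x \<longrightarrow> g \<in> M w \<longrightarrow> 0 \<le> inner (y - g) (x - w))"
  unfolding monotone_operator_def op_domain_def by blast

lemma maximal_monotone_memI:
  assumes "maximal_monotone M" "\<And>w g. g \<in> M w \<Longrightarrow> 0 \<le> inner (y - g) (x - w)"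
  shows "y \<in> M x"
proof (rule ccontr)
  assume no: "y \<notin> M x"
  define M' where "M' = M(x := insert y (M x))"
  have sym: "inner (y - g) (x - w) = inner (g - y) (w - x)" for g w
    by (simp add: inner_simps inner_commute)
  have "monotone_operator M'"
    using assms unfolding maximal_monotone_def monotone_operator_iff M'_def
    by (auto simp: sym)
  moreover have "op_graph M \<subset> op_graph M'"
    using no by (auto simp: op_graph_def M'_def)
  ultimately show False using assms(1) unfolding maximal_monotone_def by blast
qed

text \<open>
  The easy half of Minty's theorem: a monotone operator \<open>M\<close> with \<open>I + M\<close> onto cannot be extended,
  since the equation \<open>w + M w \<ni> x + y\<close> forces any additional point \<open>(x, y)\<close> to lie on the graph.
\<close>

lemma maximal_monotoneI:
  assumes mono: "monotone_operator M" and range: "\<And>z. \<exists>x. z - x \<in> M x"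
  shows "maximal_monotone M"
  unfolding maximal_monotone_def
proof (intro conjI mono notI, elim exE conjE)
  fix M' assume M': "monotone_operator M'" "op_graph M \<subset> op_graph M'"
  then obtain x y where xy: "y \<in> M' x" "y \<notin> M x" by (auto simp: op_graph_def)
  obtain w where w: "(x + y) - w \<in> M w" using range by blast
  then have "(x + y) - w \<in> M' w" using M' by (auto simp: op_graph_def)
  with M' xy have "0 \<le> inner (y - ((x + y) - w)) (x - w)" unfolding monotone_operator_iff by blast
  then have "0 \<le> - inner (x - w) (x - w)" by (simp add: inner_simps inner_commute)
  then have "inner (x - w) (x - w) = 0" by (metis inner_ge_zero neg_0_le_iff_le order_antisym)
  then have "x = w" by simp
  with w xy show False by simp
qed

text \<open>
  Completing the square: the set of \<open>x\<close> for which \<open>(x, - x)\<close> is monotonically related to a given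
  point \<open>(w, g)\<close> of the graph is a ball. This is what makes the intersection property applicable to the
  equation \<open>0 \<in> x + M x\<close>.
\<close>

lemma monotone_compatible_set_eq_cball:
  fixes w g :: "'a::real_inner"
  shows "{x. 0 \<le> inner (g + x) (w - x)} = cball ((1/2) *\<^sub>R (w - g)) (norm (w + g) / 2)"
proof -
  have "0 \<le> inner (g + x) (w - x) \<longleftrightarrow> norm ((1/2) *\<^sub>R (w - g) - x) \<le> norm (w + g) / 2" for x
  proof -
    have "(norm ((1/2) *\<^sub>R (w - g) - x))\<^sup>2 + inner (g + x) (w - x) = (norm (w + g) / 2)\<^sup>2"
      by (simp add: power2_norm_eq_inner inner_simps inner_commute power_divide) (simp add: field_simps)
    moreover have "norm ((1/2) *\<^sub>R (w - g) - x) \<le> norm (w + g) / 2 \<longleftrightarrow>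
        (norm ((1/2) *\<^sub>R (w - g) - x))\<^sup>2 \<le> (norm (w + g) / 2)\<^sup>2"
      by (auto intro: power_mono power2_le_imp_le)
    ultimately show ?thesis by linarith
  qed
  then show ?thesis unfolding set_eq_iff mem_Collect_eq mem_cball dist_norm by blast
qed

text \<open>
  A finite-dimensional minimax argument. Lift each \<open>(w, g)\<close> to \<open>(w, g, inner g w)\<close> and take the convex
  hull \<open>H\<close>, which is compact. Monotonicity of the vertices propagates to all pairs of points of the
  hull, and comparing a point with itself gives \<open>inner g w \<le> c\<close> on \<open>H\<close>; hence the functional
  \<open>(norm (w - g))\<^sup>2 + 4 * c \<ge> (norm (w + g))\<^sup>2\<close> is nonnegative there. At its minimiser over \<open>H\<close>, the
  first-order condition in the direction of each vertex is the required inequality for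
  \<open>x = (w0 - g0) / 2\<close>.
\<close>

lemma monotone_compatible_point_finite:
  fixes G :: "('a::real_inner \<times> 'a) set"
  assumes "finite G" and mono: "\<And>x y w g. (x, y) \<in> G \<Longrightarrow> (w, g) \<in> G \<Longrightarrow> 0 \<le> inner (y - g) (x - w)"
  shows "\<exists>x. \<forall>(w, g)\<in>G. 0 \<le> inner (g + x) (w - x)"
proof (cases "G = {}")
  case False
  define lift where "lift = (\<lambda>(w :: 'a, g). (w, g, inner g w))"
  define H where "H = convex hull (lift ` G)"
  have pair: "inner g w' + inner g' w \<le> c + c'" if "(w, g, c) \<in> H" "(w', g', c') \<in> H" for w g c w' g' c'
  proof -
    \<comment> \<open>An affine inequality extends from the vertices to the hull. Applied with a vertex as the
      other argument, and then with a point of the hull, it covers all pairs of points of the hull.\<close>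
    have half: "H \<subseteq> {v. inner (- b, - a, 1) v \<ge> - d}"
      if "\<And>w g. (w, g) \<in> G \<Longrightarrow> inner g a + inner b w \<le> inner g w + d" for a b :: 'a and d :: real
      unfolding H_def
      using that by (intro hull_minimal convex_halfspace_ge)
        (auto simp: lift_def inner_Pair inner_commute algebra_simps)
    have vert: "inner g a + inner b w \<le> c + inner b a" if "(w, g, c) \<in> H" "(a, b) \<in> G" for w g c a b
    proof -
      have "H \<subseteq> {v. inner (- b, - a, 1) v \<ge> - inner b a}"
      proof (rule half)
        fix w g assume "(w, g) \<in> G"
        then have "0 \<le> inner (g - b) (w - a)" using mono that by blast
        then show "inner g a + inner b w \<le> inner g w + inner b a"
          by (simp add: inner_simps inner_commute)
      qed
      then have "inner (- b, - a, 1) (w, g, c) \<ge> - inner b a" using that by blast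
      then show ?thesis by (simp add: inner_Pair inner_commute)
    qed
    have "H \<subseteq> {v. inner (- g', - w', 1) v \<ge> - c'}"
    proof (rule half)
      fix a b assume "(a, b) \<in> G"
      from vert[OF \<open>(w', g', c') \<in> H\<close> this] show "inner b w' + inner g' a \<le> inner b a + c'"
        by simp
    qed
    then have "inner (- g', - w', 1) (w, g, c) \<ge> - c'" using that by blast
    then show ?thesis by (simp add: inner_Pair inner_commute)
  qed
  have "compact H" unfolding H_def by (intro finite_imp_compact_convex_hull finite_imageI assms)
  moreover have "H \<noteq> {}" using False by (auto simp: H_def)
  moreover define Q where "Q = (\<lambda>(w :: 'a, g, c). (norm (w - g))\<^sup>2 + 4 * c)"
  then have "continuous_on H Q"
    by (auto simp: case_prod_beta intro!: continuous_intros)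
  ultimately have "\<exists>v\<in>H. \<forall>u\<in>H. Q v \<le> Q u" by (intro continuous_attains_inf)
  then obtain v where v: "v \<in> H" "\<And>u. u \<in> H \<Longrightarrow> Q v \<le> Q u" by blast
  obtain w0 g0 c0 where v_eq: "v = (w0, g0, c0)" by (cases v)
  define p where "p = w0 - g0"
  have "0 \<le> (norm (w0 + g0))\<^sup>2" by simp
  also have "\<dots> = (norm p)\<^sup>2 + 4 * inner g0 w0"
    by (simp add: p_def power2_norm_add power2_norm_diff inner_commute)
  also have "\<dots> \<le> (norm p)\<^sup>2 + 4 * c0" using pair[of w0 g0 c0 w0 g0 c0] v(1) v_eq by simp
  finally have nonneg: "0 \<le> (norm p)\<^sup>2 + 4 * c0" .
  have "0 \<le> inner (g + (1/2) *\<^sub>R p) (w - (1/2) *\<^sub>R p)" if "(w, g) \<in> G" for w g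
  proof -
    define d where "d = (w - g) - p"
    have "0 \<le> t * (2 * inner p d + 4 * (inner g w - c0)) + t\<^sup>2 * (norm d)\<^sup>2" if "0 < t" "t \<le> 1" for t
    proof -
      have "(w, g, inner g w) \<in> H"
        unfolding H_def using \<open>(w, g) \<in> G\<close> by (intro hull_inc) (force simp: lift_def)
      then have "(1 - t) *\<^sub>R v + t *\<^sub>R (w, g, inner g w) \<in> H"
        using v that unfolding H_def by (intro convexD) auto
      from v(2)[OF this]
      have "(norm p)\<^sup>2 + 4 * c0 \<le> (norm (((1 - t) *\<^sub>R w0 + t *\<^sub>R w) - ((1 - t) *\<^sub>R g0 + t *\<^sub>R g)))\<^sup>2
          + 4 * ((1 - t) * c0 + t * inner g w)"
        by (simp add: v_eq p_def Q_def)
      also have "((1 - t) *\<^sub>R w0 + t *\<^sub>R w) - ((1 - t) *\<^sub>R g0 + t *\<^sub>R g) = p + t *\<^sub>R d"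
        by (simp add: d_def p_def algebra_simps)
      finally show ?thesis unfolding power2_norm_add
        by (simp add: power_mult_distrib algebra_simps)
    qed
    from linear_le_quadratic_imp_nonneg[OF this]
    have "0 \<le> 2 * inner p d + 4 * (inner g w - c0)" .
    then show ?thesis using nonneg unfolding d_def
      by (simp add: power2_norm_eq_inner inner_simps inner_commute)
  qed
  then show ?thesis by blast
qed simp

lemma monotone_compatible_point:
  fixes G :: "('a::{real_inner, complete_space} \<times> 'a) set"
  assumes mono: "\<And>x y w g. (x, y) \<in> G \<Longrightarrow> (w, g) \<in> G \<Longrightarrow> 0 \<le> inner (y - g) (x - w)"
  shows "\<exists>x. \<forall>(w, g)\<in>G. 0 \<le> inner (g + x) (w - x)"
proof (cases "G = {}")
  case False
  define C where "C = (\<lambda>(w :: 'a, g). {x. 0 \<le> inner (g + x) (w - x)})"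
  have C: "\<exists>a r. C v = cball a r" for v
    unfolding C_def by (cases v) (auto simp: monotone_compatible_set_eq_cball)
  obtain v where "v \<in> G" using False by blast
  have "\<Inter>(C ` G) \<noteq> {}"
  proof (rule closed_convex_finite_intersection_property)
    show "closed D" "convex D" if "D \<in> C ` G" for D
      using that C by (metis closed_cball convex_cball imageE)+
    show "C v \<in> C ` G" "bounded (C v)" using \<open>v \<in> G\<close> C[of v] by auto
    fix F assume "finite F" "F \<subseteq> C ` G"
    then obtain G' where G': "finite G'" "G' \<subseteq> G" "F = C ` G'" by (meson finite_subset_image)
    have "\<exists>x. \<forall>(w, g)\<in>G'. 0 \<le> inner (g + x) (w - x)"
      using G' mono by (intro monotone_compatible_point_finite) blast+
    then show "\<Inter>F \<noteq> {}" using G' by (fastforce simp: C_def)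
  qed
  then show ?thesis by (fastforce simp: C_def)
qed simp

text \<open>
  Minty's theorem: by the intersection property and the finite case there is a point that is
  monotonically related to the whole (shifted and scaled) graph, and maximality puts it on the graph.
\<close>

lemma maximal_monotone_range:
  fixes M :: "'a::{real_inner, complete_space} \<Rightarrow> 'a set"
  assumes max: "maximal_monotone M" and l: "0 < l"
  shows "\<exists>w. (1 / l) *\<^sub>R (x - w) \<in> M w"
proof -
  define G where "G = {(w - x, l *\<^sub>R g) |w g. g \<in> M w}"
  have "\<exists>u. \<forall>(w, g)\<in>G. 0 \<le> inner (g + u) (w - u)"
  proof (rule monotone_compatible_point)
    fix a b c d assume "(a, b) \<in> G" "(c, d) \<in> G"
    then obtain w g w' g' where *: "a = w - x" "b = l *\<^sub>R g" "g \<in> M w" "c = w' - x" "d = l *\<^sub>R g'" "g' \<in> M w'"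
      by (auto simp: G_def)
    then have "0 \<le> l * inner (g - g') (w - w')"
      using max l by (auto simp: maximal_monotone_def monotone_operator_iff)
    then show "0 \<le> inner (b - d) (a - c)" by (simp add: * inner_simps algebra_simps)
  qed
  then obtain u where u: "\<And>w g. g \<in> M w \<Longrightarrow> 0 \<le> inner (l *\<^sub>R g + u) (w - x - u)"
    by (fastforce simp: G_def)
  have "(1 / l) *\<^sub>R (x - (x + u)) \<in> M (x + u)"
  proof (rule maximal_monotone_memI[OF max])
    fix w g assume "g \<in> M w"
    have "inner (l *\<^sub>R g + u) (w - x - u) = l * inner ((1 / l) *\<^sub>R (x - (x + u)) - g) (x + u - w)"
      using l by (simp add: inner_simps field_simps)
    with u[OF \<open>g \<in> M w\<close>] l show "0 \<le> inner ((1 / l) *\<^sub>R (x - (x + u)) - g) (x + u - w)"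
      by (simp add: zero_le_mult_iff)
  qed
  then show ?thesis by blast
qed

text \<open>
  The inequality is equivalent to
  \<open>(l m + l n) * (norm (a m - a n))\<^sup>2 \<le> (l m - l n) * ((norm (a n))\<^sup>2 - (norm (a m))\<^sup>2)\<close>.
  So the norms increase as the weights \<open>l\<close> decrease, and a bounded increase of the norms controls the
  increments. It yields strong convergence of Yosida approximations and of penalised solutions without
  any recourse to weak limits.
\<close>

lemma convergent_of_antitone_weights:
  fixes a :: "nat \<Rightarrow> 'a::{real_inner, complete_space}"
  assumes l: "\<And>n. 0 < l n" "decseq l"
    and ineq: "\<And>m n. inner (a m - a n) (l m *\<^sub>R a m - l n *\<^sub>R a n) \<le> 0"
    and bdd: "\<And>n. norm (a n) \<le> B"
  shows "convergent a"
proof -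
  have main: "(norm (a m - a n))\<^sup>2 \<le> (norm (a n))\<^sup>2 - (norm (a m))\<^sup>2" if "m \<le> n" for m n
  proof -
    let ?D = "(norm (a n))\<^sup>2 - (norm (a m))\<^sup>2"
    have ln: "l n \<le> l m" using l(2) that by (rule decseqD)
    have "(l m + l n) * (norm (a m - a n))\<^sup>2 + (l m - l n) * ((norm (a m))\<^sup>2 - (norm (a n))\<^sup>2)
        = 2 * inner (a m - a n) (l m *\<^sub>R a m - l n *\<^sub>R a n)"
      by (simp add: power2_norm_eq_inner inner_simps inner_commute algebra_simps)
    then have *: "(l m + l n) * (norm (a m - a n))\<^sup>2 \<le> (l m - l n) * ?D"
      using ineq[of m n] by (simp add: algebra_simps)
    have pos: "0 < l m + l n" using l(1) by (simp add: add_pos_pos)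
    have "0 \<le> ?D"
    proof (rule ccontr)
      assume "\<not> 0 \<le> ?D"
      then have "(l m - l n) * ?D \<le> 0" using ln by (simp add: mult_nonneg_nonpos)
      with * have "(l m + l n) * (norm (a m - a n))\<^sup>2 \<le> 0" by linarith
      then have "a m = a n" using pos by (simp add: mult_le_0_iff)
      with \<open>\<not> 0 \<le> ?D\<close> show False by simp
    qed
    then have "(l m - l n) * ?D \<le> (l m + l n) * ?D" using l(1)[of n] by (intro mult_right_mono) auto
    with * pos show ?thesis by (meson mult_le_cancel_left_pos order_trans)
  qed
  have "incseq (\<lambda>n. (norm (a n))\<^sup>2)"
  proof (rule incseq_SucI)
    fix n show "(norm (a n))\<^sup>2 \<le> (norm (a (Suc n)))\<^sup>2"
      using main[of n "Suc n"] zero_le_power2[of "norm (a n - a (Suc n))"] by linarith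
  qed
  moreover have "\<And>n. (norm (a n))\<^sup>2 \<le> B\<^sup>2" using bdd by (auto intro: power_mono)
  ultimately have "convergent (\<lambda>n. (norm (a n))\<^sup>2)" by (metis incseq_convergent convergent_def)
  then have C: "Cauchy (\<lambda>n. (norm (a n))\<^sup>2)" by (rule convergent_Cauchy)
  have "Cauchy a"
  proof (rule metric_CauchyI)
    fix e :: real assume "0 < e"
    then obtain N where N: "\<And>m n. N \<le> m \<Longrightarrow> N \<le> n \<Longrightarrow> dist ((norm (a m))\<^sup>2) ((norm (a n))\<^sup>2) < e\<^sup>2"
      using metric_CauchyD[OF C, of "e\<^sup>2"] by auto
    have *: "dist (a m) (a n) < e" if "N \<le> m" "m \<le> n" for m n
    proof -
      have "(dist (a m) (a n))\<^sup>2 < e\<^sup>2"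
        using main[OF that(2)] N[of m n] that by (auto simp: dist_norm dist_real_def)
      then show ?thesis by (rule power2_less_imp_less) (use \<open>0 < e\<close> in auto)
    qed
    have "dist (a m) (a n) < e" if "N \<le> m" "N \<le> n" for m n
      using *[of m n] *[of n m] that by (metis dist_commute nle_le)
    then show "\<exists>N. \<forall>m\<ge>N. \<forall>n\<ge>N. dist (a m) (a n) < e" by blast
  qed
  then show ?thesis by (rule Cauchy_convergent)
qed

locale maximal_monotone_op =
  fixes M :: "'a::{real_inner, complete_space} \<Rightarrow> 'a set"
  assumes max: "maximal_monotone M"
begin

definition resolvent :: "real \<Rightarrow> 'a \<Rightarrow> 'a" where
  "resolvent l x = (SOME w. (1 / l) *\<^sub>R (x - w) \<in> M w)"

definition yosida :: "real \<Rightarrow> 'a \<Rightarrow> 'a" where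
  "yosida l x = (1 / l) *\<^sub>R (x - resolvent l x)"

definition min_section :: "'a \<Rightarrow> 'a" where
  "min_section x = arg_min_on norm (M x)"

lemma mono: "y \<in> M x \<Longrightarrow> g \<in> M w \<Longrightarrow> 0 \<le> inner (y - g) (x - w)"
  using max by (auto simp: maximal_monotone_def monotone_operator_iff)

lemma yosida_mem: "0 < l \<Longrightarrow> yosida l x \<in> M (resolvent l x)"
  unfolding yosida_def resolvent_def using maximal_monotone_range[OF max] by (rule someI_ex)

lemma resolvent_mem_domain: "0 < l \<Longrightarrow> resolvent l x \<in> op_domain M"
  using yosida_mem by (rule mem_op_domain)

lemma diff_resolvent: "0 < l \<Longrightarrow> x - resolvent l x = l *\<^sub>R yosida l x"
  by (simp add: yosida_def)

lemma resolvent_nonexpansive: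
  assumes "0 < l" shows "norm (resolvent l x - resolvent l z) \<le> norm (x - z)"
proof -
  let ?d = "resolvent l x - resolvent l z"
  have "0 \<le> l * inner (yosida l x - yosida l z) ?d"
    using assms by (simp add: mono yosida_mem)
  also have "\<dots> = inner (l *\<^sub>R yosida l x - l *\<^sub>R yosida l z) ?d" by (simp add: inner_simps algebra_simps)
  also have "\<dots> = inner (x - z) ?d - (norm ?d)\<^sup>2"
    unfolding diff_resolvent[OF assms, symmetric] by (simp add: power2_norm_eq_inner inner_simps)
  finally have "(norm ?d)\<^sup>2 \<le> norm (x - z) * norm ?d"
    using norm_cauchy_schwarz[of "x - z" ?d] by linarith
  then show ?thesis by (cases "norm ?d = 0") (auto simp: power2_eq_square)
qed

lemma yosida_lipschitz:
  assumes "0 < l" shows "norm (yosida l x - yosida l z) \<le> (2 / l) * norm (x - z)"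
proof -
  have "yosida l x - yosida l z = (1 / l) *\<^sub>R ((x - z) - (resolvent l x - resolvent l z))"
    by (simp add: yosida_def algebra_simps)
  then have "norm (yosida l x - yosida l z) = (1 / l) * norm ((x - z) - (resolvent l x - resolvent l z))"
    using assms by simp
  also have "\<dots> \<le> (1 / l) * (norm (x - z) + norm (x - z))"
  proof (rule mult_left_mono)
    show "norm ((x - z) - (resolvent l x - resolvent l z)) \<le> norm (x - z) + norm (x - z)"
      using resolvent_nonexpansive[OF assms, of x z]
        norm_triangle_ineq4[of "x - z" "resolvent l x - resolvent l z"] by linarith
  qed (use assms in simp)
  finally show ?thesis by simp
qed

lemma yosida_tendsto:
  assumes "0 < l" "(f \<longlongrightarrow> x) F" shows "((\<lambda>n. yosida l (f n)) \<longlongrightarrow> yosida l x) F"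
proof (rule LIM_zero_cancel, rule Lim_null_comparison)
  have "((\<lambda>n. (2 / l) * norm (f n - x)) \<longlongrightarrow> (2 / l) * norm (x - x)) F"
    by (intro tendsto_intros assms)
  then show "((\<lambda>n. (2 / l) * norm (f n - x)) \<longlongrightarrow> 0) F" by simp
  show "\<forall>\<^sub>F n in F. norm (yosida l (f n) - yosida l x) \<le> (2 / l) * norm (f n - x)"
    using yosida_lipschitz[OF assms(1)] by simp
qed

text \<open>
  The vector \<open>y - yosida l x\<close> makes an acute angle with \<open>yosida l x\<close>. Thus as soon as the norms of \<open>y\<close>
  and of the Yosida approximation are close, so are the vectors themselves.
\<close>

lemma yosida_norm_diff:
  assumes "0 < l" "y \<in> M x"
  shows "(norm (y - yosida l x))\<^sup>2 \<le> (norm y)\<^sup>2 - (norm (yosida l x))\<^sup>2"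
proof -
  have "0 \<le> inner (y - yosida l x) (x - resolvent l x)" using assms by (simp add: mono yosida_mem)
  then have "0 \<le> inner (y - yosida l x) (yosida l x)"
    using assms by (simp add: diff_resolvent zero_le_mult_iff)
  then show ?thesis by (simp add: power2_norm_eq_inner inner_simps inner_commute)
qed

lemma yosida_norm_le:
  assumes "0 < l" "y \<in> M x" shows "norm (yosida l x) \<le> norm y"
proof (rule power2_le_imp_le)
  show "(norm (yosida l x))\<^sup>2 \<le> (norm y)\<^sup>2"
    using yosida_norm_diff[OF assms] zero_le_power2[of "norm (y - yosida l x)"] by linarith
qed simp

lemma graph_closed:
  assumes "\<And>n::nat. y n \<in> M (x n)" "x \<longlonglongrightarrow> x0" "y \<longlonglongrightarrow> y0"
  shows "y0 \<in> M x0"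
proof (rule maximal_monotone_memI[OF max])
  fix w g assume "g \<in> M w"
  have "(\<lambda>n. inner (y n - g) (x n - w)) \<longlonglongrightarrow> inner (y0 - g) (x0 - w)"
    by (intro tendsto_intros assms)
  moreover have "\<And>n. 0 \<le> inner (y n - g) (x n - w)" using assms(1) \<open>g \<in> M w\<close> mono by blast
  ultimately show "0 \<le> inner (y0 - g) (x0 - w)" by (simp add: LIMSEQ_le_const)
qed

lemma closed_values: "closed (M x)"
  unfolding closed_sequential_limits using graph_closed[of _ "\<lambda>_. x"] by auto

lemma convex_values: "convex (M x)"
proof (rule convexI)
  fix y z and u v :: real assume *: "y \<in> M x" "z \<in> M x" "0 \<le> u" "0 \<le> v" "u + v = 1"
  show "u *\<^sub>R y + v *\<^sub>R z \<in> M x"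
  proof (rule maximal_monotone_memI[OF max])
    fix w g assume g: "g \<in> M w"
    have "(u *\<^sub>R y + v *\<^sub>R z) - g = u *\<^sub>R (y - g) + v *\<^sub>R (z - g)"
      using *(5) by (simp add: algebra_simps flip: scaleR_add_left)
    moreover have "0 \<le> u * inner (y - g) (x - w) + v * inner (z - g) (x - w)"
      using * g mono by simp
    ultimately show "0 \<le> inner (u *\<^sub>R y + v *\<^sub>R z - g) (x - w)" by (simp only: inner_add_left inner_scaleR_left)
  qed
qed

lemma min_section_is_min:
  assumes "x \<in> op_domain M" shows "is_min_norm_element (M x) (min_section x)"
proof -
  obtain y where y: "y \<in> M x" "\<And>z. z \<in> M x \<Longrightarrow> norm y \<le> norm z"
    using min_norm_exists[OF closed_values convex_values] assms by (auto simp: op_domain_def)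
  then have "is_arg_min norm (\<lambda>y. y \<in> M x) y" by (auto simp: is_arg_min_linorder)
  then have "is_arg_min norm (\<lambda>y. y \<in> M x) (min_section x)"
    unfolding min_section_def arg_min_on_def arg_min_def by (rule someI)
  then show ?thesis
    by (intro is_min_norm_elementI convex_values) (auto simp: is_arg_min_linorder)
qed

lemma min_section_mem: "x \<in> op_domain M \<Longrightarrow> min_section x \<in> M x"
  using min_section_is_min by (auto simp: is_min_norm_element_def)

lemma min_section_eqI: "y \<in> M x \<Longrightarrow> norm y \<le> norm (min_section x) \<Longrightarrow> y = min_section x"
  using min_section_is_min[OF mem_op_domain] unfolding is_min_norm_element_def by (metis leD)

lemma min_section_norm_le: "y \<in> M x \<Longrightarrow> norm (min_section x) \<le> norm y"
  using min_section_eqI by (metis nle_le)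

text \<open>
  For two parameters the resolvents of \<open>x\<close> differ by the difference of \<open>l *\<^sub>R yosida l x\<close>, so monotonicity
  is exactly the hypothesis of \<open>convergent_of_antitone_weights\<close>; the limit is in \<open>M x\<close> since the
  graph is closed.
\<close>

lemma yosida_bounded_imp_convergent:
  assumes "\<And>n. norm (yosida (inverse (real (Suc n))) x) \<le> B"
  obtains y where "y \<in> M x" "(\<lambda>n. yosida (inverse (real (Suc n))) x) \<longlonglongrightarrow> y" "norm y \<le> B"
proof -
  define l where "l n = inverse (real (Suc n))" for n
  define a where "a n = yosida (l n) x" for n
  have l: "0 < l n" for n by (simp add: l_def)
  have "convergent a"
  proof (rule convergent_of_antitone_weights)
    show "decseq l" by (auto simp: decseq_def l_def field_simps)
    show "inner (a m - a n) (l m *\<^sub>R a m - l n *\<^sub>R a n) \<le> 0" for m n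
    proof -
      have "0 \<le> inner (a m - a n) (resolvent (l m) x - resolvent (l n) x)"
        unfolding a_def by (intro mono yosida_mem l)
      moreover have "resolvent (l m) x - resolvent (l n) x = - (l m *\<^sub>R a m - l n *\<^sub>R a n)"
        unfolding a_def diff_resolvent[OF l, symmetric] by simp
      ultimately show ?thesis by (simp only: inner_minus_right)
    qed
    show "norm (a n) \<le> B" for n using assms by (simp add: a_def l_def)
  qed (rule l)
  then obtain y where y: "a \<longlonglongrightarrow> y" by (auto simp: convergent_def)
  have "(\<lambda>n. x - l n *\<^sub>R a n) \<longlonglongrightarrow> x - 0 *\<^sub>R y"
    unfolding l_def by (intro tendsto_intros y LIMSEQ_inverse_real_of_nat)
  moreover have "x - l n *\<^sub>R a n = resolvent (l n) x" for n
    unfolding a_def diff_resolvent[OF l, symmetric] by simp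
  ultimately have "(\<lambda>n. resolvent (l n) x) \<longlonglongrightarrow> x" by simp
  then have "y \<in> M x" 
    by (rule graph_closed[OF _ _ y, rotated]) (auto simp: a_def intro: yosida_mem l)
  moreover have "norm y \<le> B"
    using assms by (intro LIMSEQ_le_const2[OF tendsto_norm[OF y]]) (auto simp: a_def l_def)
  ultimately show thesis using that y unfolding a_def l_def by blast
qed

lemma yosida_tendsto_min_section:
  assumes "x \<in> op_domain M"
  shows "(\<lambda>n. yosida (inverse (real (Suc n))) x) \<longlonglongrightarrow> min_section x"
proof -
  have "norm (yosida (inverse (real (Suc n))) x) \<le> norm (min_section x)" for n
    using min_section_mem[OF assms] by (intro yosida_norm_le) auto
  from yosida_bounded_imp_convergent[OF this] show ?thesis using min_section_eqI by metis
qed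

text \<open>
  Usually proved by extracting a weak limit of \<open>y\<close>. Here the bound on \<open>y n\<close> bounds the Yosida
  approximations at \<open>x n\<close>, and, these being continuous, also those at \<open>x0\<close>.
\<close>

lemma domain_closed_under_bounded_limits:
  assumes "\<And>n::nat. y n \<in> M (x n)" "\<And>n. norm (y n) \<le> B" "x \<longlonglongrightarrow> x0"
  shows "x0 \<in> op_domain M" "norm (min_section x0) \<le> B"
proof -
  have "norm (yosida l x0) \<le> B" if "0 < l" for l
  proof (rule LIMSEQ_le_const2)
    show "(\<lambda>n. norm (yosida l (x n))) \<longlonglongrightarrow> norm (yosida l x0)"
      by (intro tendsto_norm yosida_tendsto that assms)
    show "\<exists>N. \<forall>n\<ge>N. norm (yosida l (x n)) \<le> B"
      using yosida_norm_le[OF that assms(1)] assms(2) order_trans by blast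
  qed
  then have "\<And>n. norm (yosida (inverse (real (Suc n))) x0) \<le> B" by simp
  from yosida_bounded_imp_convergent[OF this] obtain y where "y \<in> M x0" "norm y \<le> B" by blast
  then show "x0 \<in> op_domain M" "norm (min_section x0) \<le> B"
    using min_section_norm_le order_trans by (blast intro: mem_op_domain)+
qed

end

section \<open>Adding the normal cone of a convex set with interior\<close>

lemma normal_cone_iff: "p \<in> normal_cone K z \<longleftrightarrow> z \<in> K \<and> (\<forall>q\<in>K. 0 \<le> inner p (z - q))"
  by (auto simp: normal_cone_def)

lemma scaleR_diff_nearest_point_mem_normal_cone:
  fixes K :: "'a::{real_inner, complete_space} set"
  assumes "closed K" "convex K" "K \<noteq> {}" "0 \<le> c"
  shows "c *\<^sub>R (x - nearest_point K x) \<in> normal_cone K (nearest_point K x)"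
proof -
  have "inner (x - nearest_point K x) (q - nearest_point K x) \<le> 0" if "q \<in> K" for q
    by (rule nearest_point_variational[OF assms(1-3) that])
  then have "0 \<le> inner (x - nearest_point K x) (nearest_point K x - q)" if "q \<in> K" for q
    using that by (simp add: inner_diff_right)
  then show ?thesis using nearest_point_mem[OF assms(1-3)] assms(4) by (simp add: normal_cone_iff)
qed

lemma normal_cone_monotone:
  assumes "p \<in> normal_cone K x" "q \<in> normal_cone K z"
  shows "0 \<le> inner (p - q) (x - z)"
proof -
  have "0 \<le> inner p (x - z)" "0 \<le> inner q (z - x)" using assms by (auto simp: normal_cone_iff)
  then show ?thesis by (simp add: inner_simps)
qed

text \<open>
  The normal cone is replaced by its Yosida approximation \<open>(I - P) / l\<close>, where \<open>P\<close> is the nearest-point map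
  of \<open>K\<close>. Moving \<open>(1 / l) *\<^sub>R P x\<close> to the right-hand side turns the equation into a fixed-point equation for
  a contraction with constant \<open>1 / (1 + l)\<close>.
\<close>

lemma (in maximal_monotone_op) penalised_inclusion_solvable:
  fixes K :: "'a set"
  assumes K: "closed K" "convex K" "K \<noteq> {}" and l: "0 < l"
  shows "\<exists>x. f - x - (1 / l) *\<^sub>R (x - nearest_point K x) \<in> M x"
proof -
  \<comment> \<open>The resolvent parameter with \<open>1 / m = 1 + 1 / l\<close>, which absorbs both multiples of \<open>x\<close>.\<close>
  define m where "m = l / (1 + l)"
  have m: "0 < m" using l by (simp add: m_def)
  let ?arg = "\<lambda>x. m *\<^sub>R (f + (1 / l) *\<^sub>R nearest_point K x)"
  have "\<exists>!x. resolvent m (?arg x) = x"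
  proof (rule banach_fix_type)
    show "0 \<le> 1 / (1 + l)" "1 / (1 + l) < 1" using l by auto
    show "\<forall>x y. dist (resolvent m (?arg x)) (resolvent m (?arg y)) \<le> 1 / (1 + l) * dist x y"
    proof (intro allI)
      fix x y
      have "dist (resolvent m (?arg x)) (resolvent m (?arg y)) \<le> norm (?arg x - ?arg y)"
        unfolding dist_norm by (rule resolvent_nonexpansive[OF m])
      also have "?arg x - ?arg y = (1 / (1 + l)) *\<^sub>R (nearest_point K x - nearest_point K y)"
        using l by (simp add: m_def algebra_simps)
      also have "norm \<dots> \<le> 1 / (1 + l) * dist x y"
        using l nearest_point_nonexpansive[OF K, of x y] by (simp add: dist_norm divide_right_mono)
      finally show "dist (resolvent m (?arg x)) (resolvent m (?arg y)) \<le> 1 / (1 + l) * dist x y" .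
    qed
  qed
  then obtain x where x: "resolvent m (?arg x) = x" by blast
  have inv: "1 / m = 1 + 1 / l" using l by (simp add: m_def field_simps)
  have "yosida m (?arg x) = (f + (1 / l) *\<^sub>R nearest_point K x) - (1 / m) *\<^sub>R x"
    using m unfolding yosida_def x by (simp add: scaleR_diff_right)
  also have "\<dots> = f - x - (1 / l) *\<^sub>R (x - nearest_point K x)"
    unfolding inv by (simp add: algebra_simps)
  finally show ?thesis using yosida_mem[OF m, of "?arg x"] unfolding x by auto
qed

text \<open>
  Solve the penalised equations with parameters \<open>l k \<rightarrow> 0\<close>. A ball around \<open>z0\<close> inside \<open>K\<close> bounds the
  penalty terms \<open>n k\<close>: testing \<open>n k\<close>, a normal vector at \<open>P (x k)\<close>, against the point of the ball in its own
  direction gives \<open>r * norm (n k) \<le> inner (n k) (x k - z0)\<close>, and monotonicity of \<open>M\<close> bounds the right-hand side.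
  Monotonicity of \<open>M\<close> and of the normal cone then give the hypothesis of
  \<open>convergent_of_antitone_weights\<close>, so \<open>n k\<close> converges strongly, \<open>x k\<close> converges with it, and closedness of both
  graphs gives a solution of the limit equation.
\<close>

lemma (in maximal_monotone_op) maximal_monotone_add_normal_cone:
  fixes K :: "'a set"
  assumes K: "closed K" "convex K" and z0: "z0 \<in> op_domain M" "z0 \<in> interior K"
  shows "maximal_monotone (\<lambda>z. {a + b |a b. a \<in> M z \<and> b \<in> normal_cone K z})"
proof (rule maximal_monotoneI)
  show "monotone_operator (\<lambda>z. {a + b |a b. a \<in> M z \<and> b \<in> normal_cone K z})"
    unfolding monotone_operator_iff
  proof (intro allI impI, clarify)
    fix x w a a' b b'
    assume "a \<in> M x" "b \<in> normal_cone K x" "a' \<in> M w" "b' \<in> normal_cone K w"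
    then have "0 \<le> inner (a - a') (x - w)" "0 \<le> inner (b - b') (x - w)"
      using mono normal_cone_monotone by blast+
    then show "0 \<le> inner (a + b - (a' + b')) (x - w)" by (simp add: inner_simps)
  qed
next
  fix f
  have ne: "K \<noteq> {}" using z0 interior_subset by blast
  let ?P = "nearest_point K"
  define l where "l k = inverse (real (Suc k))" for k
  have l: "0 < l k" for k by (simp add: l_def)
  have "\<forall>k. \<exists>x. f - x - (1 / l k) *\<^sub>R (x - ?P x) \<in> M x"
    using penalised_inclusion_solvable[OF K ne l] by blast
  then obtain x where x0: "\<And>k. f - x k - (1 / l k) *\<^sub>R (x k - ?P (x k)) \<in> M (x k)" by metis
  define n where "n k = (1 / l k) *\<^sub>R (x k - ?P (x k))" for k
  have x: "f - x k - n k \<in> M (x k)" for k using x0 by (simp add: n_def)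
  have n: "n k \<in> normal_cone K (?P (x k))" for k
    unfolding n_def using l[of k] by (intro scaleR_diff_nearest_point_mem_normal_cone K ne) auto
  have Px: "x k - ?P (x k) = l k *\<^sub>R n k" for k using l[of k] by (simp add: n_def)
  obtain r where r: "0 < r" "cball z0 r \<subseteq> K"
    using z0(2) by (meson mem_interior_cball)
  obtain m0 where m0: "m0 \<in> M z0" using z0(1) by (auto simp: op_domain_def)
  define h where "h = f - z0 - m0"
  have bound: "norm (n k) \<le> (norm h)\<^sup>2 / (4 * r)" for k
  proof -
    have "r * norm (n k) \<le> inner (n k) (x k - z0)"
    proof (cases "n k = 0")
      case False
      let ?q = "z0 + (r / norm (n k)) *\<^sub>R n k"
      have "?q \<in> K" using r False by (intro subsetD[OF r(2)]) (simp add: dist_norm)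
      then have "0 \<le> inner (n k) (?P (x k) - ?q)" using n[of k] by (auto simp: normal_cone_iff)
      moreover have "0 \<le> inner (n k) (x k - ?P (x k))" unfolding Px using l[of k] by simp
      moreover have "inner (n k) ((r / norm (n k)) *\<^sub>R n k) = r * norm (n k)"
        using False by (simp add: power2_norm_eq_inner[symmetric] power2_eq_square)
      ultimately show ?thesis by (simp add: inner_simps)
    qed simp
    also have "\<dots> \<le> inner h (x k - z0) - (norm (x k - z0))\<^sup>2"
    proof -
      have "0 \<le> inner (f - x k - n k - m0) (x k - z0)" by (rule mono[OF x m0])
      also have "f - x k - n k - m0 = h - (x k - z0) - n k" by (simp add: h_def)
      finally show ?thesis by (simp add: inner_diff_left power2_norm_eq_inner)
    qed
    also have "\<dots> \<le> (norm h)\<^sup>2 / 4"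
    proof -
      have "0 \<le> (norm ((1/2) *\<^sub>R h - (x k - z0)))\<^sup>2" by simp
      then show ?thesis unfolding power2_norm_diff by (simp add: power_divide)
    qed
    finally show ?thesis using r by (simp add: field_simps)
  qed
  have xdiff: "inner (n i - n j) (x i - x j) \<le> - (norm (x i - x j))\<^sup>2" for i j
  proof -
    have "0 \<le> inner ((f - x i - n i) - (f - x j - n j)) (x i - x j)" by (rule mono[OF x x])
    also have "(f - x i - n i) - (f - x j - n j) = - (x i - x j) - (n i - n j)" by simp
    finally show ?thesis by (simp add: inner_diff_left power2_norm_eq_inner)
  qed
  have "convergent n"
  proof (rule convergent_of_antitone_weights[OF l])
    show "decseq l" by (auto simp: decseq_def l_def field_simps)
    show "inner (n i - n j) (l i *\<^sub>R n i - l j *\<^sub>R n j) \<le> 0" for i j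
    proof -
      have "0 \<le> inner (n i - n j) (?P (x i) - ?P (x j))" by (rule normal_cone_monotone[OF n n])
      moreover have "l i *\<^sub>R n i - l j *\<^sub>R n j = (x i - x j) - (?P (x i) - ?P (x j))"
        unfolding Px[symmetric] by simp
      ultimately show ?thesis
        using xdiff[of i j] zero_le_power2[of "norm (x i - x j)"] by (simp only: inner_diff_right)
    qed
  qed (rule bound)
  then obtain n0 where n0: "n \<longlonglongrightarrow> n0" by (auto simp: convergent_def)
  have "norm (x i - x j) \<le> norm (n i - n j)" for i j
  proof -
    have "- inner (n i - n j) (x i - x j) \<le> norm (n i - n j) * norm (x i - x j)"
      by (metis abs_le_D2 Cauchy_Schwarz_ineq2)
    then have "(norm (x i - x j))\<^sup>2 \<le> norm (n i - n j) * norm (x i - x j)" using xdiff[of i j] by linarith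
    then show ?thesis by (cases "norm (x i - x j) = 0") (auto simp: power2_eq_square)
  qed
  then have "Cauchy x"
    using LIMSEQ_imp_Cauchy[OF n0] unfolding Cauchy_def dist_norm by (meson le_less_trans)
  then obtain y where y: "x \<longlonglongrightarrow> y" using Cauchy_convergent by (auto simp: convergent_def)
  have "(\<lambda>k. x k - l k *\<^sub>R n k) \<longlonglongrightarrow> y - 0 *\<^sub>R n0"
    unfolding l_def by (intro tendsto_intros y n0 LIMSEQ_inverse_real_of_nat)
  moreover have "x k - l k *\<^sub>R n k = ?P (x k)" for k unfolding Px[symmetric] by simp
  ultimately have Py: "(\<lambda>k. ?P (x k)) \<longlonglongrightarrow> y" by simp
  have "f - y - n0 \<in> M y"
    by (rule graph_closed[OF x y]) (intro tendsto_intros y n0)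
  moreover have "n0 \<in> normal_cone K y"
    unfolding normal_cone_iff
  proof (intro conjI ballI)
    show "y \<in> K" using closed_sequentially[OF K(1) _ Py] nearest_point_mem[OF K ne] by blast
    fix q assume "q \<in> K"
    have "(\<lambda>k. inner (n k) (?P (x k) - q)) \<longlonglongrightarrow> inner n0 (y - q)" by (intro tendsto_intros n0 Py)
    moreover have "0 \<le> inner (n k) (?P (x k) - q)" for k
      using n[of k] \<open>q \<in> K\<close> by (auto simp: normal_cone_iff)
    ultimately show "0 \<le> inner n0 (y - q)" by (simp add: LIMSEQ_le_const)
  qed
  ultimately show "\<exists>z. f - z \<in> {a + b |a b. a \<in> M z \<and> b \<in> normal_cone K z}"
    by (intro exI[of _ y] CollectI exI[of _ "f - y - n0"] exI[of _ n0]) simp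
qed

section \<open>The contraction semigroup generated by a maximal monotone operator\<close>

lemma Cauchy_if_geometric_increments:
  fixes x :: "nat \<Rightarrow> 'a::metric_space"
  assumes q: "0 \<le> q" "q < 1" and C: "0 \<le> C" and step: "\<And>k. dist (x k) (x (Suc k)) \<le> C * q ^ k"
  shows "Cauchy x"
proof -
  have tail: "dist (x k) (x (k + m)) \<le> C * q ^ k / (1 - q)" for k m
  proof (induction m arbitrary: k)
    case 0
    then show ?case using q C by simp
  next
    case (Suc m)
    have "dist (x k) (x (k + Suc m)) \<le> dist (x k) (x (Suc k)) + dist (x (Suc k)) (x (Suc k + m))"
      using dist_triangle by simp
    also have "\<dots> \<le> C * q ^ k + C * q ^ Suc k / (1 - q)" using step Suc.IH by (intro add_mono)
    also have "\<dots> = C * q ^ k / (1 - q)" using q by (simp add: field_simps)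
    finally show ?case .
  qed
  have lim: "(\<lambda>k. C * q ^ k / (1 - q)) \<longlonglongrightarrow> C * 0 / (1 - q)"
    using q by (intro tendsto_intros LIMSEQ_power_zero) auto
  show ?thesis
  proof (rule metric_CauchyI)
    fix e :: real assume "0 < e"
    then obtain N where N: "C * q ^ N / (1 - q) < e / 2"
      using order_tendstoD(2)[OF lim, of "e / 2"] by (auto simp: eventually_sequentially)
    have *: "dist (x N) (x m) < e / 2" if "N \<le> m" for m
    proof -
      have "dist (x N) (x m) \<le> C * q ^ N / (1 - q)" using tail[of N "m - N"] that by simp
      then show ?thesis using N by linarith
    qed
    have "dist (x m) (x n) < e" if "N \<le> m" "N \<le> n" for m n
      using *[OF that(1)] *[OF that(2)] dist_triangle_half_r by blast
    then show "\<exists>N. \<forall>m\<ge>N. \<forall>n\<ge>N. dist (x m) (x n) < e" by blast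
  qed
qed

text \<open>
  In this form right derivatives can be shifted along a semigroup.
\<close>

lemma has_vector_derivative_at_right_iff:
  fixes f :: "real \<Rightarrow> 'a::real_normed_vector"
  shows "(f has_vector_derivative d) (at_right t) \<longleftrightarrow>
    ((\<lambda>h. (1 / h) *\<^sub>R (f (t + h) - f t)) \<longlongrightarrow> d) (at_right 0)"
proof -
  have "(f has_vector_derivative d) (at_right t) \<longleftrightarrow>
      ((\<lambda>y. (1 / norm (y - t)) *\<^sub>R (f y - (f t + (y - t) *\<^sub>R d))) \<longlongrightarrow> 0) (at_right t)"
    unfolding has_vector_derivative_def has_derivative_within
    by (simp add: bounded_linear_scaleR_left)
  also have "\<dots> \<longleftrightarrow> ((\<lambda>h. (1 / norm h) *\<^sub>R (f (t + h) - (f t + h *\<^sub>R d))) \<longlongrightarrow> 0) (at_right 0)"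
    unfolding filterlim_at_right_to_0[of _ _ t] by (simp add: add.commute)
  also have "\<dots> \<longleftrightarrow> ((\<lambda>h. (1 / h) *\<^sub>R (f (t + h) - f t) - d) \<longlongrightarrow> 0) (at_right 0)"
    by (intro tendsto_cong eventually_at_right_less[THEN eventually_mono])
      (auto simp: algebra_simps)
  also have "\<dots> \<longleftrightarrow> ((\<lambda>h. (1 / h) *\<^sub>R (f (t + h) - f t)) \<longlongrightarrow> d) (at_right 0)"
    by (rule Lim_null[symmetric])
  finally show ?thesis .
qed

lemma nat_floor_bounds:
  assumes "0 \<le> (a::real)" shows "real (nat \<lfloor>a\<rfloor>) \<le> a" "a < real (nat \<lfloor>a\<rfloor>) + 1"
  using assms by linarith+

lemma nat_floor_scaled_tendsto:
  assumes "0 \<le> (t::real)"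
  shows "(\<lambda>k. real (nat \<lfloor>t * 2 ^ k\<rfloor>) * (1/2) ^ k) \<longlonglongrightarrow> t"
proof (rule tendsto_sandwich)
  have "(\<lambda>k. t - (1/2) ^ k) \<longlonglongrightarrow> t - 0" by (intro tendsto_intros LIMSEQ_power_zero) auto
  then show "(\<lambda>k. t - (1/2::real) ^ k) \<longlonglongrightarrow> t" by simp
  have b: "t - (1/2) ^ k \<le> real (nat \<lfloor>t * 2 ^ k\<rfloor>) * (1/2) ^ k \<and> real (nat \<lfloor>t * 2 ^ k\<rfloor>) * (1/2) ^ k \<le> t" for k
  proof -
    have "t * 2 ^ k - 1 \<le> real (nat \<lfloor>t * 2 ^ k\<rfloor>)" "real (nat \<lfloor>t * 2 ^ k\<rfloor>) \<le> t * 2 ^ k"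
      using nat_floor_bounds[of "t * 2 ^ k"] assms by auto
    from this[THEN divide_right_mono, of "2 ^ k"] show ?thesis
      by (simp add: power_one_over diff_divide_distrib)
  qed
  show "\<forall>\<^sub>F k in sequentially. t - (1/2) ^ k \<le> real (nat \<lfloor>t * 2 ^ k\<rfloor>) * (1/2) ^ k"
    "\<forall>\<^sub>F k in sequentially. real (nat \<lfloor>t * 2 ^ k\<rfloor>) * (1/2) ^ k \<le> t"
    using b by auto
qed auto

context maximal_monotone_op
begin

text \<open>
  The points at which the minimal section has norm at most \<open>L\<close>, written so that membership is visibly
  invariant under resolvents. All estimates on the semigroup are uniform on these sets.
\<close>

definition sublevel :: "real \<Rightarrow> 'a set" where
  "sublevel L = {x. \<exists>y\<in>M x. norm y \<le> L}"

lemma sublevel_min_section: "x \<in> op_domain M \<Longrightarrow> x \<in> sublevel (norm (min_section x))"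
  using min_section_mem by (auto simp: sublevel_def)

lemma sublevel_domain: "x \<in> sublevel L \<Longrightarrow> x \<in> op_domain M"
  by (auto simp: sublevel_def mem_op_domain)

lemma sublevel_nonneg: "x \<in> sublevel L \<Longrightarrow> 0 \<le> L"
  by (auto simp: sublevel_def intro: order_trans[OF norm_ge_zero])

lemma sublevel_min_section_le: "x \<in> sublevel L \<Longrightarrow> norm (min_section x) \<le> L"
  using min_section_norm_le order_trans by (fastforce simp: sublevel_def)

lemma yosida_norm_le_sublevel: "0 < h \<Longrightarrow> x \<in> sublevel L \<Longrightarrow> norm (yosida h x) \<le> L"
  using yosida_norm_le order_trans by (fastforce simp: sublevel_def)

lemma resolvent_sublevel: "0 < h \<Longrightarrow> x \<in> sublevel L \<Longrightarrow> resolvent h x \<in> sublevel L"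
  using yosida_norm_le_sublevel yosida_mem unfolding sublevel_def by blast

lemma iterate_sublevel: "0 < h \<Longrightarrow> x \<in> sublevel L \<Longrightarrow> (resolvent h ^^ n) x \<in> sublevel L"
  by (induction n) (auto intro: resolvent_sublevel)

lemma resolvent_displacement:
  assumes "0 < h" "x \<in> sublevel L" shows "norm (resolvent h x - x) \<le> h * L"
proof -
  have "norm (resolvent h x - x) = norm (h *\<^sub>R yosida h x)"
    by (metis assms(1) diff_resolvent norm_minus_commute)
  then show ?thesis using assms yosida_norm_le_sublevel by simp
qed

lemma iterate_displacement_add:
  assumes "0 < h" "x \<in> sublevel L"
  shows "norm ((resolvent h ^^ (n + m)) x - (resolvent h ^^ n) x) \<le> real m * h * L"
proof (induction m)
  case (Suc m)
  let ?a = "(resolvent h ^^ n) x" and ?b = "(resolvent h ^^ (n + m)) x"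
  have "norm ((resolvent h ^^ (n + Suc m)) x - ?a) \<le> norm (resolvent h ?b - ?b) + norm (?b - ?a)"
    using norm_triangle_ineq[of "resolvent h ?b - ?b" "?b - ?a"] by simp
  also have "\<dots> \<le> h * L + real m * h * L"
    by (rule add_mono[OF resolvent_displacement[OF assms(1) iterate_sublevel[OF assms]] Suc.IH])
  finally show ?case by (simp add: algebra_simps)
qed simp

lemma iterate_displacement:
  assumes "0 < h" "x \<in> sublevel L"
  shows "norm ((resolvent h ^^ n) x - (resolvent h ^^ m) x) \<le> \<bar>real n - real m\<bar> * h * L"
proof (cases "m \<le> n")
  case True
  then show ?thesis using iterate_displacement_add[OF assms, of m "n - m"] by (simp add: of_nat_diff)
next
  case False
  then show ?thesis using iterate_displacement_add[OF assms, of n "m - n"]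
    by (simp add: of_nat_diff norm_minus_commute)
qed

lemma iterate_nonexpansive:
  "0 < h \<Longrightarrow> norm ((resolvent h ^^ n) x - (resolvent h ^^ n) z) \<le> norm (x - z)"
  by (induction n) (auto intro: order_trans[OF resolvent_nonexpansive])

text \<open>
  The heart of the convergence proof: one implicit Euler step of length \<open>h\<close> against two of length
  \<open>h / 2\<close>. The two updates differ by \<open>(h/2) *\<^sub>R ((y - p) + (y - q))\<close>. The pairing of \<open>y - q\<close> with the new
  difference \<open>u1 - v2\<close> is nonnegative by monotonicity; for \<open>y - p\<close> the same holds up to replacing
  \<open>v2\<close> by \<open>v1\<close>, which costs only \<open>(h/2) * L\<close>. The squared error thus grows by at most \<open>h\<^sup>2 * L\<^sup>2\<close> per step,
  hence by \<open>t * h * L\<^sup>2\<close> up to time \<open>t\<close>.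
\<close>

lemma step_halving:
  assumes h: "0 < h" and u: "u \<in> sublevel L" and v: "v \<in> sublevel L"
  shows "(norm (resolvent h u - resolvent (h/2) (resolvent (h/2) v)))\<^sup>2 \<le> (norm (u - v))\<^sup>2 + h\<^sup>2 * L\<^sup>2"
proof -
  have h2: "0 < h / 2" using h by simp
  define u1 v1 v2 where "u1 = resolvent h u" and "v1 = resolvent (h/2) v" and "v2 = resolvent (h/2) v1"
  define y p q where "y = yosida h u" and "p = yosida (h/2) v" and "q = yosida (h/2) v1"
  have v1s: "v1 \<in> sublevel L" unfolding v1_def by (rule resolvent_sublevel[OF h2 v])
  have mem: "y \<in> M u1" "p \<in> M v1" "q \<in> M v2"
    unfolding u1_def v1_def v2_def y_def p_def q_def by (intro yosida_mem h h2)+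
  have bd: "norm y \<le> L" "norm p \<le> L" "norm q \<le> L"
    unfolding y_def p_def q_def by (intro yosida_norm_le_sublevel h h2 u v v1s)+
  have d: "u - u1 = h *\<^sub>R y" "v - v1 = (h/2) *\<^sub>R p" "v1 - v2 = (h/2) *\<^sub>R q"
    unfolding u1_def v1_def v2_def y_def p_def q_def by (intro diff_resolvent h h2)+
  have "inner q (y - p) \<ge> - (L * (L + L))"
  proof -
    have "norm (y - p) \<le> L + L" using bd norm_triangle_ineq4[of y p] by linarith
    then have "norm q * norm (y - p) \<le> L * (L + L)"
      using bd sublevel_nonneg[OF u] by (intro mult_mono) auto
    moreover have "\<bar>inner q (y - p)\<bar> \<le> norm q * norm (y - p)" by (rule Cauchy_Schwarz_ineq2)
    ultimately show ?thesis by linarith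
  qed
  then have "(h/2) * inner q (y - p) \<ge> (h/2) * (- (L * (L + L)))" using h by (intro mult_left_mono) auto
  then have "inner (v1 - v2) (y - p) \<ge> - (h * L\<^sup>2)"
    unfolding d by (simp add: power2_eq_square algebra_simps)
  moreover have "0 \<le> inner (u1 - v1) (y - p)" "0 \<le> inner (u1 - v2) (y - q)"
    using mono[OF mem(1) mem(2)] mono[OF mem(1) mem(3)] by (simp_all add: inner_commute)
  ultimately have "inner (u1 - v2) ((y - p) + (y - q)) \<ge> - (h * L\<^sup>2)"
    by (simp add: inner_simps)
  then have "h * inner (u1 - v2) ((y - p) + (y - q)) \<ge> h * - (h * L\<^sup>2)" using h by (intro mult_left_mono) auto
  then have "h * inner (u1 - v2) ((y - p) + (y - q)) \<ge> - (h\<^sup>2 * L\<^sup>2)" by (simp add: power2_eq_square)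
  moreover have "u - v = (u1 - v2) + (h/2) *\<^sub>R ((y - p) + (y - q))"
  proof -
    have "u - v = (u1 - v2) + ((u - u1) - (v - v1) - (v1 - v2))" by simp
    also have "(u - u1) - (v - v1) - (v1 - v2) = (h/2) *\<^sub>R ((y - p) + (y - q))"
      unfolding d by (simp add: algebra_simps flip: scaleR_add_left)
    finally show ?thesis .
  qed
  then have "(norm (u - v))\<^sup>2 = (norm (u1 - v2))\<^sup>2 + h * inner (u1 - v2) ((y - p) + (y - q))
      + (norm ((h/2) *\<^sub>R ((y - p) + (y - q))))\<^sup>2"
    using power2_norm_add[of "u1 - v2" "(h/2) *\<^sub>R ((y - p) + (y - q))"] by simp
  ultimately have "(norm (u1 - v2))\<^sup>2 \<le> (norm (u - v))\<^sup>2 + h\<^sup>2 * L\<^sup>2"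
    using zero_le_power2[of "norm ((h/2) *\<^sub>R ((y - p) + (y - q)))"] by linarith
  then show ?thesis by (simp add: u1_def v2_def v1_def)
qed

lemma iterate_halving:
  assumes h: "0 < h" and x: "x \<in> sublevel L"
  shows "(norm ((resolvent h ^^ n) x - (resolvent (h/2) ^^ (2 * n)) x))\<^sup>2 \<le> real n * (h\<^sup>2 * L\<^sup>2)"
proof (induction n)
  case (Suc n)
  have "(norm ((resolvent h ^^ Suc n) x - (resolvent (h/2) ^^ (2 * Suc n)) x))\<^sup>2
      \<le> (norm ((resolvent h ^^ n) x - (resolvent (h/2) ^^ (2 * n)) x))\<^sup>2 + h\<^sup>2 * L\<^sup>2"
    using h x by (simp, intro step_halving iterate_sublevel) auto
  with Suc show ?case by (simp add: algebra_simps)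
qed simp

text \<open>
  Implicit Euler with dyadic step \<open>(1/2) ^ k\<close>; dyadic steps make consecutive approximations comparable
  by \<open>step_halving\<close>.
\<close>

definition euler :: "nat \<Rightarrow> real \<Rightarrow> 'a \<Rightarrow> 'a" where
  "euler k t x = (resolvent ((1/2) ^ k) ^^ nat \<lfloor>t * 2 ^ k\<rfloor>) x"

text \<open>
  Crandall and Liggett's exponential formula, along dyadic steps.
\<close>

definition semigroup :: "real \<Rightarrow> 'a \<Rightarrow> 'a" where
  "semigroup t x = lim (\<lambda>k. euler k t x)"

lemma euler_nonexpansive: "norm (euler k t x - euler k t z) \<le> norm (x - z)"
  unfolding euler_def by (rule iterate_nonexpansive) simp

lemma euler_sublevel: "x \<in> sublevel L \<Longrightarrow> euler k t x \<in> sublevel L"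
  unfolding euler_def by (rule iterate_sublevel) simp

lemma euler_increment:
  assumes t: "0 \<le> t" and x: "x \<in> sublevel L"
  shows "dist (euler k t x) (euler (Suc k) t x) \<le> L * (sqrt t + 1) * sqrt (1/2) ^ k"
proof -
  define h :: real where "h = (1/2) ^ k"
  have h: "0 < h" "h \<le> 1" by (auto simp: h_def power_le_one)
  have sq: "sqrt (1/2) ^ k = sqrt h" by (simp add: h_def real_sqrt_power)
  have L: "0 \<le> L" by (rule sublevel_nonneg[OF x])
  define n m where "n = nat \<lfloor>t * 2 ^ k\<rfloor>" and "m = nat \<lfloor>t * 2 ^ Suc k\<rfloor>"
  have n: "real n \<le> t * 2 ^ k" "t * 2 ^ k < real n + 1"
    unfolding n_def using t by (intro nat_floor_bounds; simp)+
  have m: "real m \<le> t * 2 ^ Suc k" "t * 2 ^ Suc k < real m + 1"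
    unfolding m_def using t by (intro nat_floor_bounds; simp)+
  have "real m < real (2 * n + 2)" "real (2 * n) < real (m + 1)" using n m by simp_all
  then have "m = 2 * n \<or> m = 2 * n + 1" by linarith
  \<comment> \<open>Rounding makes the two time grids differ by at most one fine step.\<close>
  then have mn: "\<bar>real (2 * n) - real m\<bar> \<le> 1" by auto
  have "norm ((resolvent h ^^ n) x - (resolvent (h/2) ^^ (2 * n)) x) \<le> L * sqrt t * sqrt h"
  proof (rule power2_le_imp_le)
    have "real n * h \<le> t" using n(1) by (simp add: h_def field_simps)
    then have "(real n * h) * (h * L\<^sup>2) \<le> t * (h * L\<^sup>2)" using h by (intro mult_right_mono) auto
    moreover have "(real n * h) * (h * L\<^sup>2) = real n * (h\<^sup>2 * L\<^sup>2)" by (simp add: power2_eq_square)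
    moreover have "(L * sqrt t * sqrt h)\<^sup>2 = t * (h * L\<^sup>2)" using t h by (simp add: power_mult_distrib)
    ultimately have "real n * (h\<^sup>2 * L\<^sup>2) \<le> (L * sqrt t * sqrt h)\<^sup>2" by simp
    with iterate_halving[OF h(1) x, of n]
    show "(norm ((resolvent h ^^ n) x - (resolvent (h/2) ^^ (2 * n)) x))\<^sup>2 \<le> (L * sqrt t * sqrt h)\<^sup>2"
      by linarith
    show "0 \<le> L * sqrt t * sqrt h" using L t h by simp
  qed
  moreover have "norm ((resolvent (h/2) ^^ (2 * n)) x - (resolvent (h/2) ^^ m) x) \<le> L * sqrt h"
  proof -
    have "norm ((resolvent (h/2) ^^ (2 * n)) x - (resolvent (h/2) ^^ m) x) \<le> \<bar>real (2 * n) - real m\<bar> * (h/2) * L"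
      using h by (intro iterate_displacement x) auto
    also have "\<dots> \<le> 1 * sqrt h * L"
    proof (intro mult_right_mono mult_mono mn L)
      have "h / 2 \<le> h" using h by simp
      also have "\<dots> \<le> sqrt h" using h by (intro real_le_rsqrt) (simp add: power2_eq_square mult_left_le)
      finally show "h / 2 \<le> sqrt h" .
    qed (use h in auto)
    finally show ?thesis by (simp add: mult.commute)
  qed
  moreover have "dist (euler k t x) (euler (Suc k) t x)
      = norm (((resolvent h ^^ n) x - (resolvent (h/2) ^^ (2 * n)) x)
        + ((resolvent (h/2) ^^ (2 * n)) x - (resolvent (h/2) ^^ m) x))"
    by (simp add: dist_norm euler_def h_def n_def m_def)
  ultimately have "dist (euler k t x) (euler (Suc k) t x) \<le> L * sqrt t * sqrt h + L * sqrt h"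
    using norm_triangle_mono by metis
  then show ?thesis unfolding sq by (simp add: algebra_simps)
qed

lemma euler_convergent:
  assumes t: "0 \<le> t" and x: "x \<in> closure (op_domain M)"
  shows "convergent (\<lambda>k. euler k t x)"
proof (intro Cauchy_convergent metric_CauchyI)
  fix e :: real assume "0 < e"
  then obtain z where z: "z \<in> op_domain M" "dist z x < e / 3"
    using x unfolding closure_approachable by (meson zero_less_divide_iff zero_less_numeral)
  have "Cauchy (\<lambda>k. euler k t z)"
  proof (rule Cauchy_if_geometric_increments)
    show "dist (euler k t z) (euler (Suc k) t z) \<le> norm (min_section z) * (sqrt t + 1) * sqrt (1/2) ^ k" for k
      by (rule euler_increment[OF t sublevel_min_section[OF z(1)]])
    show "sqrt (1/2) < 1" by (simp add: real_sqrt_lt_1_iff)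
  qed (use t in auto)
  then obtain N where N: "\<And>m n. N \<le> m \<Longrightarrow> N \<le> n \<Longrightarrow> dist (euler m t z) (euler n t z) < e / 3"
    using metric_CauchyD[of _ "e / 3"] \<open>0 < e\<close> by (metis zero_less_divide_iff zero_less_numeral)
  have near: "dist (euler k t x) (euler k t z) < e / 3" for k
    using euler_nonexpansive[of k t x z] z by (simp add: dist_norm norm_minus_commute)
  have "dist (euler m t x) (euler n t x) < e" if "N \<le> m" "N \<le> n" for m n
    using N[OF that] near[of m] near[of n]
      dist_triangle[of "euler m t x" "euler n t x" "euler m t z"]
      dist_triangle[of "euler m t z" "euler n t x" "euler n t z"]
      dist_commute[of "euler n t x" "euler n t z"] by linarith
  then show "\<exists>N. \<forall>m\<ge>N. \<forall>n\<ge>N. dist (euler m t x) (euler n t x) < e" by blast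
qed

lemma euler_tendsto:
  "0 \<le> t \<Longrightarrow> x \<in> closure (op_domain M) \<Longrightarrow> (\<lambda>k. euler k t x) \<longlonglongrightarrow> semigroup t x"
  unfolding semigroup_def using euler_convergent by (simp add: convergent_LIMSEQ_iff)

lemma domain_subset_closure: "x \<in> op_domain M \<Longrightarrow> x \<in> closure (op_domain M)"
  using closure_subset by blast

lemma semigroup_closure:
  assumes "0 \<le> t" "x \<in> closure (op_domain M)"
  shows "semigroup t x \<in> closure (op_domain M)"
proof -
  have "(resolvent h ^^ n) x \<in> closure (op_domain M)" if "0 < h" for h n
    using that assms(2) by (cases n) (auto intro: domain_subset_closure resolvent_mem_domain)
  then have "\<And>k. euler k t x \<in> closure (op_domain M)" by (simp add: euler_def)
  then show ?thesis using closed_sequentially[OF closed_closure _ euler_tendsto[OF assms]] by blast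
qed

lemma semigroup_sublevel:
  assumes "0 \<le> t" "x \<in> sublevel L" shows "semigroup t x \<in> sublevel L"
proof -
  have "\<forall>k. \<exists>y. y \<in> M (euler k t x) \<and> norm y \<le> L"
    using euler_sublevel[OF assms(2)] by (auto simp: sublevel_def)
  then obtain y where y: "\<And>k. y k \<in> M (euler k t x)" "\<And>k. norm (y k) \<le> L" by metis
  have lim: "(\<lambda>k. euler k t x) \<longlonglongrightarrow> semigroup t x"
    by (intro euler_tendsto domain_subset_closure sublevel_domain[OF assms(2)] assms(1))
  from domain_closed_under_bounded_limits[OF y lim] show ?thesis
    using min_section_mem by (auto simp: sublevel_def)
qed

lemma semigroup_domain: "0 \<le> t \<Longrightarrow> x \<in> op_domain M \<Longrightarrow> semigroup t x \<in> op_domain M"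
  using semigroup_sublevel sublevel_min_section sublevel_domain by blast

lemma semigroup_zero: "semigroup 0 x = x"
  by (simp add: semigroup_def euler_def)

lemma semigroup_nonexpansive:
  assumes "0 \<le> t" "x \<in> closure (op_domain M)" "z \<in> closure (op_domain M)"
  shows "norm (semigroup t x - semigroup t z) \<le> norm (x - z)"
proof (rule LIMSEQ_le_const2)
  show "(\<lambda>k. norm (euler k t x - euler k t z)) \<longlonglongrightarrow> norm (semigroup t x - semigroup t z)"
    by (intro tendsto_intros euler_tendsto assms)
qed (use euler_nonexpansive in blast)

lemma semigroup_tendsto:
  assumes "0 \<le> t" "x \<in> closure (op_domain M)" "\<And>n. z n \<in> closure (op_domain M)" "z \<longlonglongrightarrow> x"
  shows "(\<lambda>n. semigroup t (z n)) \<longlonglongrightarrow> semigroup t x"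
proof (rule LIM_zero_cancel, rule Lim_null_comparison)
  show "\<forall>\<^sub>F n in sequentially. norm (semigroup t (z n) - semigroup t x) \<le> norm (z n - x)"
    using semigroup_nonexpansive[OF assms(1,3,2)] by simp
  show "(\<lambda>n. norm (z n - x)) \<longlonglongrightarrow> 0" using assms(4) LIM_zero tendsto_norm_zero by blast
qed

lemma semigroup_lipschitz:
  assumes "0 \<le> t" "0 \<le> s" "x \<in> sublevel L"
  shows "norm (semigroup t x - semigroup s x) \<le> L * \<bar>t - s\<bar>"
proof (rule LIMSEQ_le)
  have x: "x \<in> closure (op_domain M)" by (intro domain_subset_closure sublevel_domain[OF assms(3)])
  show "(\<lambda>k. norm (euler k t x - euler k s x)) \<longlonglongrightarrow> norm (semigroup t x - semigroup s x)"
    by (intro tendsto_intros euler_tendsto assms x)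
  let ?n = "\<lambda>t k. real (nat \<lfloor>t * 2 ^ k\<rfloor>)"
  have "(\<lambda>k. \<bar>?n t k * (1/2) ^ k - ?n s k * (1/2) ^ k\<bar> * L) \<longlonglongrightarrow> \<bar>t - s\<bar> * L"
    by (intro tendsto_intros nat_floor_scaled_tendsto assms)
  then show "(\<lambda>k. \<bar>?n t k * (1/2) ^ k - ?n s k * (1/2) ^ k\<bar> * L) \<longlonglongrightarrow> L * \<bar>t - s\<bar>"
    by (simp add: mult.commute)
  have "norm (euler k t x - euler k s x) \<le> \<bar>?n t k * (1/2) ^ k - ?n s k * (1/2) ^ k\<bar> * L" for k
  proof -
    have "norm (euler k t x - euler k s x) \<le> \<bar>?n t k - ?n s k\<bar> * (1/2) ^ k * L"
      unfolding euler_def by (intro iterate_displacement assms) simp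
    also have "\<bar>?n t k - ?n s k\<bar> * (1/2) ^ k = \<bar>?n t k * (1/2) ^ k - ?n s k * (1/2) ^ k\<bar>"
      by (simp add: abs_mult flip: left_diff_distrib)
    finally show ?thesis .
  qed
  then show "\<exists>N. \<forall>k\<ge>N. norm (euler k t x - euler k s x) \<le> \<bar>?n t k * (1/2) ^ k - ?n s k * (1/2) ^ k\<bar> * L"
    by blast
qed

lemma semigroup_add_sublevel:
  assumes t: "0 \<le> t" and s: "0 \<le> s" and x: "x \<in> sublevel L"
  shows "semigroup (t + s) x = semigroup t (semigroup s x)"
proof -
  have xc: "x \<in> closure (op_domain M)" by (intro domain_subset_closure sublevel_domain[OF x])
  have shift: "norm (euler k (t + s) x - euler k t (euler k s x)) \<le> (1/2) ^ k * L" for k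
  proof -
    define n m p where "n = nat \<lfloor>t * 2 ^ k\<rfloor>" and "m = nat \<lfloor>s * 2 ^ k\<rfloor>" and "p = nat \<lfloor>(t + s) * 2 ^ k\<rfloor>"
    have "real n \<le> t * 2 ^ k" "t * 2 ^ k < real n + 1" "real m \<le> s * 2 ^ k" "s * 2 ^ k < real m + 1"
      "real p \<le> (t + s) * 2 ^ k" "(t + s) * 2 ^ k < real p + 1"
      unfolding n_def m_def p_def using t s by (intro nat_floor_bounds; simp)+
    then have "real p < real (n + m + 2)" "real (n + m) < real (p + 1)" by (simp_all add: algebra_simps)
    then have "p = n + m \<or> p = n + m + 1" by linarith
    then have pm: "\<bar>real p - real (n + m)\<bar> \<le> 1" by auto
    have "euler k t (euler k s x) = (resolvent ((1/2) ^ k) ^^ (n + m)) x"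
      by (simp add: euler_def n_def m_def funpow_add)
    then have "norm (euler k (t + s) x - euler k t (euler k s x)) \<le> \<bar>real p - real (n + m)\<bar> * (1/2) ^ k * L"
      using iterate_displacement[OF _ x, of "(1/2) ^ k" p "n + m"] by (simp add: euler_def p_def)
    also have "\<dots> \<le> 1 * (1/2) ^ k * L" using pm sublevel_nonneg[OF x] by (intro mult_right_mono) auto
    finally show ?thesis by simp
  qed
  have "(\<lambda>k. (1/2) ^ k * L) \<longlonglongrightarrow> 0 * L" by (intro tendsto_intros LIMSEQ_power_zero) auto
  then have "(\<lambda>k. euler k (t + s) x - euler k t (euler k s x)) \<longlonglongrightarrow> 0"
    by (intro Lim_null_comparison[OF always_eventually[OF allI[OF shift]]]) simp
  moreover have "(\<lambda>k. euler k t (euler k s x) - euler k t (semigroup s x)) \<longlonglongrightarrow> 0"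
  proof (rule Lim_null_comparison)
    show "\<forall>\<^sub>F k in sequentially. norm (euler k t (euler k s x) - euler k t (semigroup s x)) \<le> norm (euler k s x - semigroup s x)"
      using euler_nonexpansive by simp
    show "(\<lambda>k. norm (euler k s x - semigroup s x)) \<longlonglongrightarrow> 0"
      using euler_tendsto[OF s xc] LIM_zero tendsto_norm_zero by blast
  qed
  moreover have "(\<lambda>k. euler k t (semigroup s x)) \<longlonglongrightarrow> semigroup t (semigroup s x)"
    by (intro euler_tendsto t semigroup_closure s xc)
  ultimately have "(\<lambda>k. (euler k (t + s) x - euler k t (euler k s x))
      + ((euler k t (euler k s x) - euler k t (semigroup s x)) + euler k t (semigroup s x)))
      \<longlonglongrightarrow> 0 + (0 + semigroup t (semigroup s x))"
    by (intro tendsto_add)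
  then have "(\<lambda>k. euler k (t + s) x) \<longlonglongrightarrow> semigroup t (semigroup s x)" by simp
  moreover have "(\<lambda>k. euler k (t + s) x) \<longlonglongrightarrow> semigroup (t + s) x"
    using t s by (intro euler_tendsto xc) auto
  ultimately show ?thesis by (rule LIMSEQ_unique[symmetric])
qed

lemma semigroup_add:
  assumes t: "0 \<le> t" and s: "0 \<le> s" and x: "x \<in> closure (op_domain M)"
  shows "semigroup (t + s) x = semigroup t (semigroup s x)"
proof -
  obtain z where z: "\<And>n. z n \<in> op_domain M" "z \<longlonglongrightarrow> x"
    using x by (auto simp: closure_sequential)
  have "(\<lambda>n. semigroup (t + s) (z n)) \<longlonglongrightarrow> semigroup (t + s) x"
    using t s z x by (intro semigroup_tendsto) (auto intro: domain_subset_closure)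
  moreover have "(\<lambda>n. semigroup t (semigroup s (z n))) \<longlonglongrightarrow> semigroup t (semigroup s x)"
    using t s z x by (intro semigroup_tendsto semigroup_closure) (auto intro: domain_subset_closure)
  then have "(\<lambda>n. semigroup (t + s) (z n)) \<longlonglongrightarrow> semigroup t (semigroup s x)"
    by (simp add: semigroup_add_sublevel[OF t s sublevel_min_section[OF z(1)]])
  ultimately show ?thesis by (rule LIMSEQ_unique)
qed

lemma semigroup_continuous:
  assumes x: "x \<in> closure (op_domain M)"
  shows "continuous_on {0..} (\<lambda>t. semigroup t x)"
  unfolding continuous_on_iff
proof (intro ballI allI impI)
  fix t e :: real assume t: "t \<in> {0..}" and "0 < e"
  then obtain z where z: "z \<in> op_domain M" "dist z x < e / 3"
    using x unfolding closure_approachable by (meson zero_less_divide_iff zero_less_numeral)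
  define L where "L = norm (min_section z) + 1"
  have L: "0 < L" "z \<in> sublevel L"
    using min_section_mem[OF z(1)]
    by (auto simp: L_def sublevel_def add_nonneg_pos intro!: bexI[of _ "min_section z"])
  have "dist (semigroup s x) (semigroup t x) < e" if s: "s \<in> {0..}" "dist s t < e / (3 * L)" for s
  proof -
    have "norm (semigroup r x - semigroup r z) < e / 3" if "r \<in> {0..}" for r
      using semigroup_nonexpansive[of r x z] that x z
      by (auto simp: dist_norm norm_minus_commute domain_subset_closure)
    note * = this[OF s(1)] this[OF t]
    have "norm (semigroup s z - semigroup t z) \<le> L * \<bar>s - t\<bar>"
      using s t L by (intro semigroup_lipschitz) auto
    also have "\<dots> < e / 3" using s(2) L by (simp add: dist_real_def field_simps)
    finally show ?thesis
      using * dist_triangle[of "semigroup s x" "semigroup t x" "semigroup s z"]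
        dist_triangle[of "semigroup s z" "semigroup t x" "semigroup t z"]
      by (simp add: dist_norm norm_minus_commute)
  qed
  moreover have "0 < e / (3 * L)" using \<open>0 < e\<close> L by simp
  ultimately show "\<exists>d>0. \<forall>s\<in>{0..}. dist s t < d \<longrightarrow> dist (semigroup s x) (semigroup t x) < e" by blast
qed

text \<open>
  Each implicit Euler step satisfies \<open>h * inner g (v - w) \<le> inner (u - v) (v - w)\<close>, so the squared distance to \<open>w\<close>
  drops by at least \<open>2 * h * inner g (v - w)\<close>; the number \<open>r\<close> controls the error of replacing \<open>v\<close> by \<open>x\<close> in the
  last inner product. In the limit this becomes a discretised form of Benilan's integral inequality, which
  determines the generator.
\<close>

lemma iterate_evolution_inequality:
  assumes h: "0 < h" and g: "g \<in> M w" and r: "\<And>i. i \<le> n \<Longrightarrow> norm ((resolvent h ^^ i) x - x) \<le> r"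
  shows "(norm ((resolvent h ^^ n) x - w))\<^sup>2 \<le> (norm (x - w))\<^sup>2 + real n * h * (2 * norm g * r - 2 * inner g (x - w))"
  using r
proof (induction n)
  case (Suc n)
  define u where "u = (resolvent h ^^ n) x"
  define v where "v = resolvent h u"
  have "0 \<le> inner (yosida h u - g) (v - w)" unfolding v_def by (intro mono yosida_mem h g)
  then have "h * inner g (v - w) \<le> h * inner (yosida h u) (v - w)" using h by (simp add: inner_diff_left)
  also have "\<dots> = inner (u - v) (v - w)" unfolding v_def diff_resolvent[OF h] by simp
  finally have 1: "h * inner g (v - w) \<le> inner (u - v) (v - w)" .
  have "(norm (u - w))\<^sup>2 = (norm (v - w))\<^sup>2 + 2 * inner (u - v) (v - w) + (norm (u - v))\<^sup>2"
    using power2_norm_add[of "v - w" "u - v"] by (simp add: inner_commute)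
  with 1 have 2: "(norm (v - w))\<^sup>2 \<le> (norm (u - w))\<^sup>2 - 2 * (h * inner g (v - w))"
    using zero_le_power2[of "norm (u - v)"] by linarith
  have "v = (resolvent h ^^ Suc n) x" by (simp add: v_def u_def)
  then have "norm (v - x) \<le> r" using Suc.prems[of "Suc n"] by simp
  then have "norm g * norm (v - x) \<le> norm g * r" by (intro mult_left_mono) auto
  moreover have "- inner g (v - x) \<le> norm g * norm (v - x)"
    by (metis abs_le_D2 Cauchy_Schwarz_ineq2)
  moreover have "inner g (v - w) = inner g (v - x) + inner g (x - w)" by (simp add: inner_simps)
  ultimately have "h * (- inner g (v - w)) \<le> h * (norm g * r - inner g (x - w))"
    using h by (intro mult_left_mono) auto
  with 2 have "(norm (v - w))\<^sup>2 \<le> (norm (u - w))\<^sup>2 + h * (2 * norm g * r - 2 * inner g (x - w))"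
    by (simp add: algebra_simps)
  also have "(norm (u - w))\<^sup>2 \<le> (norm (x - w))\<^sup>2 + real n * h * (2 * norm g * r - 2 * inner g (x - w))"
    unfolding u_def by (intro Suc.IH Suc.prems) simp
  finally show ?case unfolding \<open>v = (resolvent h ^^ Suc n) x\<close> by (simp add: algebra_simps)
qed simp

lemma semigroup_evolution_inequality_lipschitz:
  assumes t: "0 \<le> t" and x: "x \<in> sublevel L" and g: "g \<in> M w"
  shows "(norm (semigroup t x - w))\<^sup>2 \<le> (norm (x - w))\<^sup>2 + t * (2 * norm g * (t * L) - 2 * inner g (x - w))"
proof (rule LIMSEQ_le)
  let ?n = "\<lambda>k. nat \<lfloor>t * 2 ^ k\<rfloor>" and ?h = "\<lambda>k. (1/2::real) ^ k"
  have "x \<in> closure (op_domain M)" by (intro domain_subset_closure sublevel_domain[OF x])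
  then show "(\<lambda>k. (norm (euler k t x - w))\<^sup>2) \<longlonglongrightarrow> (norm (semigroup t x - w))\<^sup>2"
    by (intro tendsto_intros euler_tendsto t)
  show "(\<lambda>k. (norm (x - w))\<^sup>2 + real (?n k) * ?h k * (2 * norm g * (real (?n k) * ?h k * L) - 2 * inner g (x - w)))
    \<longlonglongrightarrow> (norm (x - w))\<^sup>2 + t * (2 * norm g * (t * L) - 2 * inner g (x - w))"
    by (intro tendsto_intros nat_floor_scaled_tendsto t)
  have "(norm (euler k t x - w))\<^sup>2
      \<le> (norm (x - w))\<^sup>2 + real (?n k) * ?h k * (2 * norm g * (real (?n k) * ?h k * L) - 2 * inner g (x - w))" for k
    unfolding euler_def
  proof (rule iterate_evolution_inequality[OF _ g])
    fix i assume i: "i \<le> ?n k"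
    have "norm ((resolvent (?h k) ^^ i) x - x) \<le> real i * ?h k * L"
      using iterate_displacement_add[OF _ x, of "?h k" 0 i] by simp
    also have "\<dots> \<le> real (?n k) * ?h k * L"
      using i sublevel_nonneg[OF x] by (intro mult_right_mono) auto
    finally show "norm ((resolvent (?h k) ^^ i) x - x) \<le> real (?n k) * ?h k * L" .
  qed simp
  then show "\<exists>N. \<forall>k\<ge>N. (norm (euler k t x - w))\<^sup>2
      \<le> (norm (x - w))\<^sup>2 + real (?n k) * ?h k * (2 * norm g * (real (?n k) * ?h k * L) - 2 * inner g (x - w))"
    by blast
qed

text \<open>
  The Lipschitz estimate, applied on each of \<open>N\<close> equal pieces of \<open>[0, t]\<close>, leaves an error of order \<open>1 / N\<close>
  besides \<open>r\<close>. What remains no longer involves \<open>L\<close> and so survives the passage to the closure of the domain.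
\<close>

lemma semigroup_evolution_inequality_domain:
  assumes t: "0 \<le> t" and x: "x \<in> sublevel L" and g: "g \<in> M w"
    and r: "\<And>s. 0 \<le> s \<Longrightarrow> s \<le> t \<Longrightarrow> norm (semigroup s x - x) \<le> r"
  shows "(norm (semigroup t x - w))\<^sup>2 \<le> (norm (x - w))\<^sup>2 + t * (2 * norm g * r - 2 * inner g (x - w))"
proof -
  have xc: "x \<in> closure (op_domain M)" by (intro domain_subset_closure sublevel_domain[OF x])
  have step: "(norm (semigroup (real j * (t / real N)) x - w))\<^sup>2
      \<le> (norm (x - w))\<^sup>2 + real j * ((t / real N) * (2 * norm g * (t / real N * L) + 2 * norm g * r - 2 * inner g (x - w)))"
    if "j \<le> N" "0 < N" for j N
    using \<open>j \<le> N\<close>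
  proof (induction j)
    case 0
    then show ?case by (simp add: semigroup_zero)
  next
    case (Suc j)
    define a where "a = t / real N"
    have a: "0 \<le> a" using t by (simp add: a_def)
    define u where "u = semigroup (real j * a) x"
    have "real j * t \<le> real N * t" using t Suc.prems by (intro mult_right_mono) auto
    then have ja: "0 \<le> real j * a" "real j * a \<le> t"
      using a \<open>0 < N\<close> by (auto simp: a_def field_simps)
    have u: "u \<in> sublevel L" unfolding u_def by (rule semigroup_sublevel[OF ja(1) x])
    have "semigroup (real (Suc j) * a) x = semigroup (a + real j * a) x" by (simp add: algebra_simps)
    also have "\<dots> = semigroup a u" unfolding u_def by (rule semigroup_add[OF a ja(1) xc])
    finally have "(norm (semigroup (real (Suc j) * a) x - w))\<^sup>2
        \<le> (norm (u - w))\<^sup>2 + a * (2 * norm g * (a * L) - 2 * inner g (u - w))"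
      using semigroup_evolution_inequality_lipschitz[OF a u g] by simp
    moreover have "norm g * norm (u - x) \<le> norm g * r"
      unfolding u_def by (intro mult_left_mono r ja) auto
    then have "- inner g (u - w) \<le> norm g * r - inner g (x - w)"
      using Cauchy_Schwarz_ineq2[of g "u - x"] by (simp add: inner_simps)
    then have "a * (2 * norm g * (a * L) - 2 * inner g (u - w))
        \<le> a * (2 * norm g * (a * L) + 2 * norm g * r - 2 * inner g (x - w))"
      using a by (intro mult_left_mono) auto
    moreover have "(norm (u - w))\<^sup>2 \<le> (norm (x - w))\<^sup>2
        + real j * (a * (2 * norm g * (a * L) + 2 * norm g * r - 2 * inner g (x - w)))"
      using Suc unfolding u_def a_def by simp
    ultimately show ?case unfolding a_def[symmetric] by (simp add: algebra_simps)
  qed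
  show ?thesis
  proof (rule LIMSEQ_le_const)
    have "(\<lambda>N. (norm (x - w))\<^sup>2 + t * (2 * norm g * (t * L * inverse (real (Suc N))) + 2 * norm g * r - 2 * inner g (x - w)))
      \<longlonglongrightarrow> (norm (x - w))\<^sup>2 + t * (2 * norm g * (t * L * 0) + 2 * norm g * r - 2 * inner g (x - w))"
      by (intro tendsto_intros LIMSEQ_inverse_real_of_nat)
    then show "(\<lambda>N. (norm (x - w))\<^sup>2 + t * (2 * norm g * (t * L * inverse (real (Suc N))) + 2 * norm g * r - 2 * inner g (x - w)))
      \<longlonglongrightarrow> (norm (x - w))\<^sup>2 + t * (2 * norm g * r - 2 * inner g (x - w))" by simp
    have "(norm (semigroup t x - w))\<^sup>2
      \<le> (norm (x - w))\<^sup>2 + t * (2 * norm g * (t * L * inverse (real (Suc N))) + 2 * norm g * r - 2 * inner g (x - w))" for N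
    proof -
      have *: "real (Suc N) * (t / real (Suc N)) = t" by simp
      have **: "real (Suc N) * (t / real (Suc N) * c) = t * c" for c by simp
      have ***: "t / real (Suc N) * L = t * L * inverse (real (Suc N))" by (simp add: field_simps)
      from step[of "Suc N" "Suc N"] show ?thesis unfolding * ** *** by simp
    qed
    then show "\<exists>N. \<forall>n\<ge>N. (norm (semigroup t x - w))\<^sup>2
      \<le> (norm (x - w))\<^sup>2 + t * (2 * norm g * (t * L * inverse (real (Suc n))) + 2 * norm g * r - 2 * inner g (x - w))"
      by blast
  qed
qed

lemma semigroup_evolution_inequality:
  assumes t: "0 \<le> t" and x: "x \<in> closure (op_domain M)" and g: "g \<in> M w"
    and r: "\<And>s. 0 \<le> s \<Longrightarrow> s \<le> t \<Longrightarrow> norm (semigroup s x - x) \<le> r"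
  shows "(norm (semigroup t x - w))\<^sup>2 \<le> (norm (x - w))\<^sup>2 + t * (2 * norm g * r - 2 * inner g (x - w))"
proof -
  obtain z where z: "\<And>n. z n \<in> op_domain M" "z \<longlonglongrightarrow> x"
    using x by (auto simp: closure_sequential)
  have zc: "z n \<in> closure (op_domain M)" for n by (intro domain_subset_closure z)
  have lhs: "(\<lambda>n. (norm (semigroup t (z n) - w))\<^sup>2) \<longlonglongrightarrow> (norm (semigroup t x - w))\<^sup>2"
    by (intro tendsto_intros semigroup_tendsto t x zc z)
  have "(\<lambda>n. (norm (z n - w))\<^sup>2 + t * (2 * norm g * (r + 2 * norm (z n - x)) - 2 * inner g (z n - w)))
    \<longlonglongrightarrow> (norm (x - w))\<^sup>2 + t * (2 * norm g * (r + 2 * norm (x - x)) - 2 * inner g (x - w))"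
    by (intro tendsto_intros z)
  then have rhs: "(\<lambda>n. (norm (z n - w))\<^sup>2 + t * (2 * norm g * (r + 2 * norm (z n - x)) - 2 * inner g (z n - w)))
    \<longlonglongrightarrow> (norm (x - w))\<^sup>2 + t * (2 * norm g * r - 2 * inner g (x - w))" by simp
  have "(norm (semigroup t (z n) - w))\<^sup>2
      \<le> (norm (z n - w))\<^sup>2 + t * (2 * norm g * (r + 2 * norm (z n - x)) - 2 * inner g (z n - w))" for n
  proof (rule semigroup_evolution_inequality_domain[OF t sublevel_min_section[OF z(1)] g])
    fix s assume s: "0 \<le> s" "s \<le> t"
    have "semigroup s (z n) - z n = (semigroup s (z n) - semigroup s x) + (semigroup s x - x) + (x - z n)"
      by simp
    also have "norm \<dots> \<le> norm (semigroup s (z n) - semigroup s x) + norm (semigroup s x - x) + norm (x - z n)"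
      by (rule order_trans[OF norm_triangle_ineq add_right_mono[OF norm_triangle_ineq]])
    also have "\<dots> \<le> norm (z n - x) + r + norm (z n - x)"
      using s by (intro add_mono semigroup_nonexpansive r zc x) (auto simp: norm_minus_commute)
    finally show "norm (semigroup s (z n) - z n) \<le> r + 2 * norm (z n - x)" by simp
  qed
  then show ?thesis by (intro LIMSEQ_le[OF lhs rhs]) blast
qed

lemma difference_quotient_inequality:
  assumes t: "0 < t" and ineq: "(norm (u - w))\<^sup>2 \<le> (norm (x - w))\<^sup>2 + t * (2 * c - 2 * inner g (x - w))"
  shows "inner (x - w) ((1 / t) *\<^sub>R (u - x)) \<le> c - inner g (x - w)"
proof -
  define d where "d = (1 / t) *\<^sub>R (u - x)"
  have "u - w = (x - w) + t *\<^sub>R d" using t by (simp add: d_def)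
  then have "(norm (u - w))\<^sup>2 = (norm (x - w))\<^sup>2 + t * (2 * inner (x - w) d) + (norm (t *\<^sub>R d))\<^sup>2"
    by (simp only: power2_norm_add) simp
  with ineq have "t * (2 * inner (x - w) d) \<le> t * (2 * c - 2 * inner g (x - w))"
    using zero_le_power2[of "norm (t *\<^sub>R d)"] by linarith
  then have "inner (x - w) d \<le> c - inner g (x - w)"
    using mult_left_le_imp_le[OF _ t] by fastforce
  then show ?thesis by (simp add: d_def)
qed

lemma yosida_near_min_section:
  assumes x: "x \<in> op_domain M" and e: "0 < e"
  obtains l where "0 < l" "norm (min_section x - yosida l x) < e"
    "(norm (min_section x))\<^sup>2 - (norm (yosida l x))\<^sup>2 < e\<^sup>2"
proof -
  note lim = yosida_tendsto_min_section[OF x]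
  have "(\<lambda>n. norm (min_section x - yosida (inverse (real (Suc n))) x)) \<longlonglongrightarrow> norm (min_section x - min_section x)"
    by (intro tendsto_intros lim)
  then have 1: "\<forall>\<^sub>F n in sequentially. norm (min_section x - yosida (inverse (real (Suc n))) x) < e"
    using e by (intro order_tendstoD(2)) auto
  have "(\<lambda>n. (norm (min_section x))\<^sup>2 - (norm (yosida (inverse (real (Suc n))) x))\<^sup>2)
      \<longlonglongrightarrow> (norm (min_section x))\<^sup>2 - (norm (min_section x))\<^sup>2"
    by (intro tendsto_intros lim)
  then have 2: "\<forall>\<^sub>F n in sequentially. (norm (min_section x))\<^sup>2 - (norm (yosida (inverse (real (Suc n))) x))\<^sup>2 < e\<^sup>2"
    using e by (intro order_tendstoD(2)) auto
  from eventually_conj[OF 1 2] obtain n where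
    "norm (min_section x - yosida (inverse (real (Suc n))) x) < e"
    "(norm (min_section x))\<^sup>2 - (norm (yosida (inverse (real (Suc n))) x))\<^sup>2 < e\<^sup>2"
    unfolding eventually_sequentially by blast
  then show thesis by (intro that[of "inverse (real (Suc n))"]) auto
qed

text \<open>
  Let \<open>d\<close> be the difference quotient at time \<open>t\<close> and \<open>L\<close> the norm of the minimal section at \<open>x\<close>, so
  \<open>norm d \<le> L\<close>. The evolution inequality with \<open>w = resolvent l x\<close> and \<open>g = yosida l x\<close> reads
  \<open>inner g d \<le> t * L\<^sup>2 / l - (norm g)\<^sup>2\<close>, whence
  \<open>(norm (d + g))\<^sup>2 \<le> L\<^sup>2 - (norm g)\<^sup>2 + 2 * t * L\<^sup>2 / l\<close>. Choosing first \<open>l\<close> and then \<open>t\<close> small makes the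
  right-hand side small, while \<open>g\<close> is close to the minimal section.
\<close>

lemma semigroup_right_derivative_zero:
  assumes x: "x \<in> op_domain M"
  shows "((\<lambda>t. (1 / t) *\<^sub>R (semigroup t x - x)) \<longlongrightarrow> - min_section x) (at_right 0)"
proof (rule tendstoI)
  fix e :: real assume e: "0 < e"
  define L where "L = norm (min_section x)"
  have xL: "x \<in> sublevel L" unfolding L_def by (rule sublevel_min_section[OF x])
  obtain l where l: "0 < l" "norm (min_section x - yosida l x) < e / 4" "L\<^sup>2 - (norm (yosida l x))\<^sup>2 < (e / 4)\<^sup>2"
    using yosida_near_min_section[OF x, of "e / 4"] e unfolding L_def by auto
  define g where "g = yosida l x"
  have gL: "norm g \<le> L" unfolding g_def by (rule yosida_norm_le_sublevel[OF l(1) xL])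
  have "((\<lambda>t. L\<^sup>2 - (norm g)\<^sup>2 + 2 * (t * L\<^sup>2 / l)) \<longlongrightarrow> L\<^sup>2 - (norm g)\<^sup>2 + 2 * (0 * L\<^sup>2 / l)) (at_right 0)"
    by (intro tendsto_intros) (use l in auto)
  moreover have "L\<^sup>2 - (norm g)\<^sup>2 + 2 * (0 * L\<^sup>2 / l) < (e / 2)\<^sup>2"
    using l(3) e unfolding g_def by (simp add: power2_eq_square)
      (smt (verit) mult_pos_pos)
  ultimately have "\<forall>\<^sub>F t in at_right 0. L\<^sup>2 - (norm g)\<^sup>2 + 2 * (t * L\<^sup>2 / l) < (e / 2)\<^sup>2"
    by (rule order_tendstoD(2))
  moreover have "\<forall>\<^sub>F t in at_right (0::real). 0 < t" by (rule eventually_at_right_less)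
  ultimately show "\<forall>\<^sub>F t in at_right 0. dist ((1 / t) *\<^sub>R (semigroup t x - x)) (- min_section x) < e"
  proof eventually_elim
    case (elim t)
    define d where "d = (1 / t) *\<^sub>R (semigroup t x - x)"
    have "(norm (semigroup t x - resolvent l x))\<^sup>2
        \<le> (norm (x - resolvent l x))\<^sup>2 + t * (2 * (norm g * (t * L)) - 2 * inner g (x - resolvent l x))"
      using semigroup_evolution_inequality_lipschitz[OF _ xL, of t g "resolvent l x"] elim l yosida_mem
      by (simp add: g_def mult.assoc)
    from difference_quotient_inequality[OF elim(2) this]
    have "l * inner g d \<le> norm g * (t * L) - l * (norm g)\<^sup>2"
      unfolding diff_resolvent[OF l(1)] g_def[symmetric] d_def[symmetric] by (simp add: power2_norm_eq_inner)
    also have "norm g * (t * L) \<le> L * (t * L)"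
      using gL elim sublevel_nonneg[OF xL] by (intro mult_right_mono) auto
    finally have "inner g d \<le> t * L\<^sup>2 / l - (norm g)\<^sup>2"
      using l(1) by (simp add: field_simps power2_eq_square)
    moreover have "norm (semigroup t x - x) \<le> L * t"
      using semigroup_lipschitz[OF _ _ xL, of t 0] elim by (simp add: semigroup_zero)
    then have "norm d \<le> L" unfolding d_def norm_scaleR using elim by (simp add: pos_divide_le_eq)
    then have "(norm d)\<^sup>2 \<le> L\<^sup>2" by (intro power_mono) auto
    ultimately have "(norm (d + g))\<^sup>2 < (e / 2)\<^sup>2"
      using elim(1) power2_norm_add[of d g] by (simp add: inner_commute)
    then have "norm (d + g) < e / 2" by (rule power2_less_imp_less) (use e in auto)
    moreover have "d + min_section x = (d + g) + (min_section x - g)" by simp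
    then have "norm (d + min_section x) \<le> norm (d + g) + norm (min_section x - g)"
      by (metis norm_triangle_ineq)
    ultimately have "norm (d + min_section x) < e" using l(2) e unfolding g_def by linarith
    then show ?case by (simp add: d_def dist_norm)
  qed
qed

lemma semigroup_right_derivative:
  assumes t: "0 \<le> t" and x: "x \<in> op_domain M"
  shows "((\<lambda>s. semigroup s x) has_vector_derivative - min_section (semigroup t x)) (at_right t)"
  unfolding has_vector_derivative_at_right_iff
proof (rule Lim_transform_eventually)
  show "((\<lambda>h. (1 / h) *\<^sub>R (semigroup h (semigroup t x) - semigroup t x)) \<longlongrightarrow> - min_section (semigroup t x)) (at_right 0)"
    by (intro semigroup_right_derivative_zero semigroup_domain t x)
  show "\<forall>\<^sub>F h in at_right 0. (1 / h) *\<^sub>R (semigroup h (semigroup t x) - semigroup t x)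
      = (1 / h) *\<^sub>R (semigroup (t + h) x - semigroup t x)"
    using eventually_at_right_less[of "0::real"]
    by eventually_elim (simp add: semigroup_add[symmetric] t x domain_subset_closure add.commute)
qed

lemma semigroup_tendsto_zero:
  assumes "x \<in> closure (op_domain M)"
  shows "((\<lambda>s. semigroup s x) \<longlongrightarrow> x) (at_right 0)"
proof -
  have "((\<lambda>s. semigroup s x) \<longlongrightarrow> semigroup 0 x) (at 0 within {0..})"
    using semigroup_continuous[OF assms] by (simp add: continuous_on_def)
  then show ?thesis unfolding semigroup_zero by (rule tendsto_within_subset) auto
qed

text \<open>
  The norm of the minimal section does not increase along the semigroup. For a fixed small \<open>l\<close>, the Yosida
  approximation at \<open>semigroup s x\<close> is continuous in \<open>s\<close> and its norm at \<open>s = 0\<close> is almost \<open>L\<close>, so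
  \<open>yosida_norm_diff\<close> keeps the minimal section close to it.
\<close>

lemma min_section_right_continuous_zero:
  assumes x: "x \<in> op_domain M"
  shows "((\<lambda>s. min_section (semigroup s x)) \<longlongrightarrow> min_section x) (at_right 0)"
proof (rule tendstoI)
  fix e :: real assume e: "0 < e"
  define L where "L = norm (min_section x)"
  have xL: "x \<in> sublevel L" unfolding L_def by (rule sublevel_min_section[OF x])
  obtain l where l: "0 < l" "norm (min_section x - yosida l x) < e / 3" "L\<^sup>2 - (norm (yosida l x))\<^sup>2 < (e / 3)\<^sup>2"
    using yosida_near_min_section[OF x, of "e / 3"] e unfolding L_def by auto
  have lim: "((\<lambda>s. yosida l (semigroup s x)) \<longlongrightarrow> yosida l x) (at_right 0)"
    by (intro yosida_tendsto l semigroup_tendsto_zero domain_subset_closure x)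
  have "((\<lambda>s. L\<^sup>2 - (norm (yosida l (semigroup s x)))\<^sup>2) \<longlongrightarrow> L\<^sup>2 - (norm (yosida l x))\<^sup>2) (at_right 0)"
    by (intro tendsto_intros lim)
  then have "\<forall>\<^sub>F s in at_right 0. L\<^sup>2 - (norm (yosida l (semigroup s x)))\<^sup>2 < (e / 3)\<^sup>2"
    using l(3) by (rule order_tendstoD(2))
  moreover have "\<forall>\<^sub>F s in at_right 0. dist (yosida l (semigroup s x)) (yosida l x) < e / 3"
    using e by (intro tendstoD[OF lim]) auto
  moreover have "\<forall>\<^sub>F t in at_right (0::real). 0 < t" by (rule eventually_at_right_less)
  ultimately show "\<forall>\<^sub>F s in at_right 0. dist (min_section (semigroup s x)) (min_section x) < e"
  proof eventually_elim
    case (elim s)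
    let ?u = "semigroup s x"
    have u: "?u \<in> sublevel L" using elim by (intro semigroup_sublevel xL) auto
    have "(norm (min_section ?u - yosida l ?u))\<^sup>2 \<le> (norm (min_section ?u))\<^sup>2 - (norm (yosida l ?u))\<^sup>2"
      by (intro yosida_norm_diff l min_section_mem sublevel_domain[OF u])
    also have "\<dots> \<le> L\<^sup>2 - (norm (yosida l ?u))\<^sup>2"
      using sublevel_min_section_le[OF u] by (simp add: power_mono)
    also have "\<dots> < (e / 3)\<^sup>2" by (rule elim)
    finally have "norm (min_section ?u - yosida l ?u) < e / 3"
      by (rule power2_less_imp_less) (use e in auto)
    with elim(2) l(2) show ?case
      using dist_triangle[of "min_section ?u" "min_section x" "yosida l ?u"]
        dist_triangle[of "yosida l ?u" "min_section x" "yosida l x"]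
      by (simp add: dist_norm norm_minus_commute)
  qed
qed

lemma min_section_right_continuous:
  assumes t: "0 \<le> t" and x: "x \<in> op_domain M"
  shows "continuous (at_right t) (\<lambda>s. min_section (semigroup s x))"
  unfolding continuous_within filterlim_at_right_to_0[of _ _ t]
proof (rule Lim_transform_eventually)
  show "((\<lambda>h. min_section (semigroup h (semigroup t x))) \<longlongrightarrow> min_section (semigroup t x)) (at_right 0)"
    by (intro min_section_right_continuous_zero semigroup_domain t x)
  show "\<forall>\<^sub>F h in at_right 0. min_section (semigroup h (semigroup t x)) = min_section (semigroup (h + t) x)"
    using eventually_at_right_less[of "0::real"]
    by eventually_elim (simp add: semigroup_add t x domain_subset_closure)
qed

text \<open>
  Dividing the evolution inequality by \<open>t\<close> shows that \<open>- d\<close> is monotonically related to every point of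
  the graph, so maximality applies.
\<close>

lemma semigroup_differentiable_imp_domain:
  assumes x: "x \<in> closure (op_domain M)"
    and d: "((\<lambda>t. (1 / t) *\<^sub>R (semigroup t x - x)) \<longlongrightarrow> d) (at_right 0)"
  shows "x \<in> op_domain M"
proof -
  have "- d \<in> M x"
  proof (rule maximal_monotone_memI[OF max])
    fix w g assume g: "g \<in> M w"
    have "inner (x - w) d \<le> norm g * r - inner g (x - w)" if r: "0 < r" for r
    proof (rule tendsto_upperbound)
      show "((\<lambda>t. inner (x - w) ((1 / t) *\<^sub>R (semigroup t x - x))) \<longlongrightarrow> inner (x - w) d) (at_right 0)"
        by (intro tendsto_intros d)
      have "\<forall>\<^sub>F s in at_right 0. dist (semigroup s x) x < r"
        by (intro tendstoD[OF semigroup_tendsto_zero[OF x]] r)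
      then obtain b where b: "0 < b" "\<And>s. 0 < s \<Longrightarrow> s < b \<Longrightarrow> dist (semigroup s x) x < r"
        unfolding eventually_at_right_field by blast
      show "\<forall>\<^sub>F t in at_right 0. inner (x - w) ((1 / t) *\<^sub>R (semigroup t x - x)) \<le> norm g * r - inner g (x - w)"
        unfolding eventually_at_right_field
      proof (intro exI[of _ b] conjI b(1) allI impI)
        fix t assume t: "0 < t" "t < b"
        have "(norm (semigroup t x - w))\<^sup>2 \<le> (norm (x - w))\<^sup>2 + t * (2 * norm g * r - 2 * inner g (x - w))"
        proof (rule semigroup_evolution_inequality[OF _ x g])
          fix s assume "0 \<le> s" "s \<le> t"
          then show "norm (semigroup s x - x) \<le> r"
            using b(2)[of s] t r by (cases "s = 0") (auto simp: semigroup_zero dist_norm)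
        qed (use t in auto)
        then show "inner (x - w) ((1 / t) *\<^sub>R (semigroup t x - x)) \<le> norm g * r - inner g (x - w)"
          by (intro difference_quotient_inequality t) (simp add: mult.assoc)
      qed
    qed simp
    note ineq = this
    have "inner (x - w) d \<le> norm g * 0 - inner g (x - w)"
    proof (rule tendsto_lowerbound)
      show "((\<lambda>r. norm g * r - inner g (x - w)) \<longlongrightarrow> norm g * 0 - inner g (x - w)) (at_right 0)"
        by (intro tendsto_intros)
      show "\<forall>\<^sub>F r in at_right 0. inner (x - w) d \<le> norm g * r - inner g (x - w)"
        using eventually_at_right_less[of "0::real"] by eventually_elim (rule ineq)
    qed simp
    then show "0 \<le> inner (- d - g) (x - w)" by (simp add: inner_simps inner_commute)
  qed
  then show ?thesis by (rule mem_op_domain)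
qed

end

section \<open>Uniqueness for dissipative right derivatives\<close>

text \<open>
  The last time up to \<open>T\<close> at which \<open>f s \<le> f 0 + c * s\<close> must be \<open>T\<close>: from an earlier time the inequality
  would persist a little longer, because the right derivative there is below \<open>c > 0\<close>.
\<close>

lemma nonpos_right_derivative_imp_le:
  fixes f :: "real \<Rightarrow> real"
  assumes cont: "continuous_on {0..} f" and T: "0 \<le> T"
    and deriv: "\<And>t. 0 \<le> t \<Longrightarrow> \<exists>d\<le>0. (f has_vector_derivative d) (at_right t)"
  shows "f T \<le> f 0"
proof (rule field_le_epsilon)
  fix e :: real assume e: "0 < e"
  define c where "c = e / (T + 1)"
  have c: "0 < c" "c * T \<le> e" using e T by (auto simp: c_def field_simps)
  define S where "S = {s \<in> {0..T}. f s - c * s \<le> f 0}"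
  have "continuous_on {0..T} (\<lambda>s. f s - c * s)"
    by (intro continuous_intros continuous_on_subset[OF cont]) auto
  then have "closed S" 
    unfolding S_def by (intro continuous_on_closed_Collect_le continuous_on_const) auto
  have S: "S \<noteq> {}" "bdd_above S" using T by (auto simp: S_def intro!: bdd_aboveI[of _ T] exI[of _ 0])
  define s where "s = Sup S"
  have sS: "s \<in> S" unfolding s_def by (rule closed_contains_Sup[OF S \<open>closed S\<close>])
  have "s = T"
  proof (rule ccontr)
    assume "s \<noteq> T"
    then have s: "0 \<le> s" "s < T" "f s - c * s \<le> f 0" using sS by (auto simp: S_def)
    obtain d where d: "d \<le> 0" "(f has_vector_derivative d) (at_right s)" using deriv[OF s(1)] by blast
    have "((\<lambda>h. (1 / h) *\<^sub>R (f (s + h) - f s)) \<longlongrightarrow> d) (at_right 0)"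
      using d(2) by (simp only: has_vector_derivative_at_right_iff)
    then have "\<forall>\<^sub>F h in at_right 0. (1 / h) *\<^sub>R (f (s + h) - f s) < c"
      by (rule order_tendstoD(2)) (use d(1) c(1) in simp)
    then obtain b where b: "0 < b" "\<And>h. 0 < h \<Longrightarrow> h < b \<Longrightarrow> (1 / h) *\<^sub>R (f (s + h) - f s) < c"
      unfolding eventually_at_right_field by blast
    define h where "h = min (b / 2) (T - s)"
    have h: "0 < h" "h < b" "s + h \<le> T" using b(1) s by (auto simp: h_def)
    have "f (s + h) - f s < c * h" using b(2)[OF h(1,2)] h(1) by (simp add: field_simps)
    then have "s + h \<in> S" using s h by (auto simp: S_def algebra_simps)
    then have "s + h \<le> s" unfolding s_def using S by (intro cSup_upper) auto
    then show False using h by simp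
  qed
  then show "f T \<le> f 0 + e" using sS c by (auto simp: S_def)
qed

lemma dissipative_solutions_coincide:
  fixes y z :: "real \<Rightarrow> 'a::real_inner"
  assumes cont: "continuous_on {0..} y" "continuous_on {0..} z" and init: "y 0 = z 0"
    and deriv: "\<And>t. 0 \<le> t \<Longrightarrow> \<exists>p q. (y has_vector_derivative p) (at_right t) \<and>
      (z has_vector_derivative q) (at_right t) \<and> inner (p - q) (y t - z t) \<le> 0"
    and T: "0 \<le> T"
  shows "y T = z T"
proof -
  define f where "f t = inner (y t - z t) (y t - z t)" for t
  have "f T \<le> f 0"
  proof (rule nonpos_right_derivative_imp_le[OF _ T])
    show "continuous_on {0..} f" unfolding f_def by (intro continuous_intros cont)
    fix t :: real assume "0 \<le> t"
    then obtain p q where pq: "(y has_vector_derivative p) (at_right t)" "(z has_vector_derivative q) (at_right t)"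
      "inner (p - q) (y t - z t) \<le> 0" using deriv by blast
    have yz: "((\<lambda>t. y t - z t) has_vector_derivative (p - q)) (at_right t)"
      by (rule has_vector_derivative_diff[OF pq(1,2)])
    have "(f has_vector_derivative (inner (y t - z t) (p - q) + inner (p - q) (y t - z t))) (at_right t)"
      unfolding f_def by (rule bounded_bilinear.has_vector_derivative[OF bounded_bilinear_inner yz yz])
    moreover have "inner (y t - z t) (p - q) + inner (p - q) (y t - z t) \<le> 0"
      using pq(3) by (simp add: inner_commute)
    ultimately show "\<exists>d\<le>0. (f has_vector_derivative d) (at_right t)" by blast
  qed
  then have "inner (y T - z T) (y T - z T) \<le> 0" by (simp add: f_def init)
  then show ?thesis by (metis inner_eq_zero_iff inner_ge_zero order_antisym right_minus_eq)
qed

section \<open>Projection onto tangent cones\<close>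

lemma zero_mem_tangent_cone: "z \<in> K \<Longrightarrow> 0 \<in> tangent_cone K z"
  unfolding tangent_cone_def by (rule subsetD[OF closure_subset]) (force intro: exI[of _ 1])

lemma diff_mem_tangent_cone: "q \<in> K \<Longrightarrow> q - z \<in> tangent_cone K z"
  unfolding tangent_cone_def by (rule subsetD[OF closure_subset]) (force intro: exI[of _ 1])

lemma closed_tangent_cone: "closed (tangent_cone K z)"
  by (simp add: tangent_cone_def)

lemma convex_tangent_cone:
  assumes "convex K" shows "convex (tangent_cone K z)"
  unfolding tangent_cone_def
proof (intro convex_closure convexI)
  fix a b and u v :: real
  assume "a \<in> {l *\<^sub>R (x - z) |l x. 0 < l \<and> x \<in> K}" "b \<in> {l *\<^sub>R (x - z) |l x. 0 < l \<and> x \<in> K}"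
    and uv: "0 \<le> u" "0 \<le> v" "u + v = 1"
  then obtain l x m w where *: "a = l *\<^sub>R (x - z)" "0 < l" "x \<in> K" "b = m *\<^sub>R (w - z)" "0 < m" "w \<in> K"
    by blast
  define k where "k = u * l + v * m"
  have k: "0 < k"
  proof (cases "u = 0")
    case True
    then show ?thesis using uv * by (simp add: k_def)
  next
    case False
    then show ?thesis using uv * by (simp add: k_def add_pos_nonneg)
  qed
  have "(u * l / k) *\<^sub>R x + (v * m / k) *\<^sub>R w \<in> K"
    using uv * k by (intro convexD[OF assms]) (auto simp: k_def simp flip: add_divide_distrib)
  moreover have "u *\<^sub>R a + v *\<^sub>R b = k *\<^sub>R (((u * l / k) *\<^sub>R x + (v * m / k) *\<^sub>R w) - z)"
  proof -
    have "k *\<^sub>R (((u * l / k) *\<^sub>R x + (v * m / k) *\<^sub>R w) - z) = (u * l) *\<^sub>R x + (v * m) *\<^sub>R w - k *\<^sub>R z"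
      using k by (simp add: scaleR_diff_right scaleR_add_right)
    then show ?thesis by (simp add: * k_def algebra_simps)
  qed
  ultimately show "u *\<^sub>R a + v *\<^sub>R b \<in> {l *\<^sub>R (x - z) |l x. 0 < l \<and> x \<in> K}" using k by blast
qed

lemma scaleR_mem_tangent_cone:
  assumes "t \<in> tangent_cone K z" "0 < c" shows "c *\<^sub>R t \<in> tangent_cone K z"
proof -
  let ?C = "{l *\<^sub>R (x - z) |l x. 0 < l \<and> x \<in> K}"
  have "(*\<^sub>R) c ` ?C \<subseteq> ?C"
  proof (clarify)
    fix l :: real and x assume "0 < l" "x \<in> K"
    then show "\<exists>l' x'. c *\<^sub>R l *\<^sub>R (x - z) = l' *\<^sub>R (x' - z) \<and> 0 < l' \<and> x' \<in> K"
      using assms(2) by (intro exI[of _ "c * l"] exI[of _ x]) simp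
  qed
  then have "(*\<^sub>R) c ` closure ?C \<subseteq> closure ?C" unfolding closure_scaleR by (rule closure_mono)
  then show ?thesis using assms(1) unfolding tangent_cone_def by blast
qed

lemma normal_tangent_inner_nonpos:
  assumes n: "n \<in> normal_cone K z" and t: "t \<in> tangent_cone K z"
  shows "inner n t \<le> 0"
proof -
  have "tangent_cone K z \<subseteq> {t. inner n t \<le> 0}"
    unfolding tangent_cone_def
  proof (rule closure_minimal[OF _ closed_halfspace_le], clarify)
    fix l :: real and x assume "0 < l" "x \<in> K"
    then have "0 \<le> l * inner n (z - x)" using n by (simp add: normal_cone_iff)
    then show "inner n (l *\<^sub>R (x - z)) \<le> 0" by (simp add: inner_diff_right algebra_simps)
  qed
  then show ?thesis using t by blast
qed

text \<open>
  One half of Moreau's decomposition for the mutually polar tangent and normal cones: the residual of the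
  projection onto the tangent cone is a normal vector, and no other normal vector brings \<open>v\<close> closer to
  the origin.
\<close>

lemma tangent_projection_moreau:
  fixes K :: "'a::{real_inner, complete_space} set"
  assumes "convex K" "z \<in> K"
  defines "p \<equiv> \<lambda>v. nearest_point (tangent_cone K z) v"
  shows diff_tangent_projection_mem_normal_cone: "v - p v \<in> normal_cone K z"
    and tangent_projection_norm_le: "\<And>n. n \<in> normal_cone K z \<Longrightarrow> norm (p v) \<le> norm (v - n)"
proof -
  have T: "closed (tangent_cone K z)" "convex (tangent_cone K z)" "tangent_cone K z \<noteq> {}"
    using closed_tangent_cone convex_tangent_cone[OF assms(1)] zero_mem_tangent_cone[OF assms(2)] by auto
  have pT: "p v \<in> tangent_cone K z" unfolding p_def by (rule nearest_point_mem[OF T])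
  have var: "inner (v - p v) (t - p v) \<le> 0" if "t \<in> tangent_cone K z" for t
    unfolding p_def by (rule nearest_point_variational[OF T that])
  \<comment> \<open>Testing with \<open>0\<close> and \<open>2 *\<^sub>R p v\<close>, both in the cone, gives orthogonality of the residual.\<close>
  have "inner (v - p v) (2 *\<^sub>R p v - p v) \<le> 0" by (intro var scaleR_mem_tangent_cone pT) simp
  moreover have "inner (v - p v) (0 - p v) \<le> 0" by (intro var zero_mem_tangent_cone assms)
  ultimately have orth: "inner (v - p v) (p v) = 0" by (simp add: inner_diff_right)
  have polar: "inner (v - p v) t \<le> 0" if "t \<in> tangent_cone K z" for t
    using var[OF that] orth by (simp add: inner_diff_right)
  show "v - p v \<in> normal_cone K z"
    unfolding normal_cone_iff
  proof (intro conjI ballI assms(2))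
    fix q assume "q \<in> K"
    then have "inner (v - p v) (q - z) \<le> 0" by (intro polar diff_mem_tangent_cone)
    then show "0 \<le> inner (v - p v) (z - q)" by (simp add: inner_diff_right)
  qed
  show "norm (p v) \<le> norm (v - n)" if n: "n \<in> normal_cone K z" for n
  proof -
    have "(norm (p v))\<^sup>2 = inner (v - n) (p v) + inner n (p v)"
      using orth by (simp add: power2_norm_eq_inner inner_diff_left)
    also have "\<dots> \<le> norm (v - n) * norm (p v)"
      using normal_tangent_inner_nonpos[OF n pT] norm_cauchy_schwarz[of "v - n" "p v"] by linarith
    finally show ?thesis by (cases "norm (p v) = 0") (auto simp: power2_eq_square)
  qed
qed

lemma cone_projection_subset_diff_normal_cone:
  fixes K :: "'a::{real_inner, complete_space} set"
  assumes "convex K"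
  shows "cone_projection K z (A z) \<subseteq> op_diff A (normal_cone K) z"
proof (cases "z \<in> K")
  case True
  show ?thesis
  proof
    fix w assume "w \<in> cone_projection K z (A z)"
    then obtain v where v: "v \<in> A z" "w = nearest_point (tangent_cone K z) v"
      using True by (auto simp: cone_projection_def)
    have "v - w \<in> normal_cone K z"
      unfolding v(2) by (rule diff_tangent_projection_mem_normal_cone[OF assms True])
    moreover have "w = v - (v - w)" by simp
    ultimately show "w \<in> op_diff A (normal_cone K) z" using v(1) unfolding op_diff_def by blast
  qed
qed (simp add: cone_projection_def)

text \<open>
  If \<open>w = a - n\<close> is the minimal element, the tangential projection of \<open>a\<close> also lies in the difference set and has
  norm at most \<open>norm (a - n)\<close>; by strict minimality it equals \<open>w\<close>. Hence minimising over the smaller set of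
  projected vectors yields the same element.
\<close>

lemma min_norm_element_cone_projection:
  fixes K :: "'a::{real_inner, complete_space} set"
  assumes "convex K" and w: "is_min_norm_element (op_diff A (normal_cone K) z) w"
  shows "is_min_norm_element (cone_projection K z (A z)) w"
proof -
  obtain a n where an: "a \<in> A z" "n \<in> normal_cone K z" "w = a - n"
    using w by (auto simp: is_min_norm_element_def op_diff_def)
  then have z: "z \<in> K" by (simp add: normal_cone_iff)
  define p where "p = nearest_point (tangent_cone K z) a"
  have p: "p \<in> cone_projection K z (A z)" using an z by (auto simp: cone_projection_def p_def)
  have "norm p \<le> norm w"
    unfolding p_def an(3) by (rule tangent_projection_norm_le[OF assms(1) z an(2)])
  then have "p = w"
    using w p cone_projection_subset_diff_normal_cone[OF assms(1), of z A]
    unfolding is_min_norm_element_def by (meson leD subsetD)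
  then show ?thesis
    using w p cone_projection_subset_diff_normal_cone[OF assms(1), of z A]
    unfolding is_min_norm_element_def by blast
qed

lemma arg_min_norm_eq: "is_min_norm_element S w \<Longrightarrow> arg_min_on norm S = w"
  unfolding arg_min_on_def arg_min_def is_arg_min_linorder is_min_norm_element_def
  by (rule some_equality) (auto simp: le_less, metis order.asym less_irrefl)

section \<open>The projected inclusion\<close>

text \<open>
  Moving from a point of \<open>K\<close> a little towards an interior point enters the interior.
\<close>

lemma closure_interior_convex:
  fixes K :: "'a::real_normed_vector set"
  assumes "convex K" "interior K \<noteq> {}"
  shows "K \<subseteq> closure (interior K)"
proof
  fix z assume z: "z \<in> K"
  obtain c e where c: "0 < e" "ball c e \<subseteq> K" using assms(2) by (auto simp: mem_interior)
  have int: "z + t *\<^sub>R (c - z) \<in> interior K" if t: "0 < t" "t \<le> 1" for t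
    unfolding mem_interior
  proof (intro exI[of _ "t * e"] conjI subsetI)
    fix y assume y: "y \<in> ball (z + t *\<^sub>R (c - z)) (t * e)"
    define x where "x = z + (1 / t) *\<^sub>R (y - z)"
    have "c - x = (1 / t) *\<^sub>R ((z + t *\<^sub>R (c - z)) - y)" using t by (simp add: x_def algebra_simps)
    then have "norm (c - x) = (1 / t) * norm ((z + t *\<^sub>R (c - z)) - y)" using t by simp
    also have "\<dots> < e" using y t by (simp add: dist_norm field_simps)
    finally have "x \<in> K" using c(2) by (auto simp: dist_norm)
    then have "(1 - t) *\<^sub>R z + t *\<^sub>R x \<in> K" using z t by (intro convexD[OF assms(1)]) auto
    also have "(1 - t) *\<^sub>R z + t *\<^sub>R x = y" using t by (simp add: x_def algebra_simps)
    finally show "y \<in> K" .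
  qed (use t c in simp)
  have "(\<lambda>n. z + inverse (real (Suc n)) *\<^sub>R (c - z)) \<longlonglongrightarrow> z + 0 *\<^sub>R (c - z)"
    by (intro tendsto_intros LIMSEQ_inverse_real_of_nat)
  moreover have "z + inverse (real (Suc n)) *\<^sub>R (c - z) \<in> interior K" for n
    by (intro int) (auto simp: field_simps)
  ultimately show "z \<in> closure (interior K)" 
    unfolding closure_sequential
    by (intro exI[of _ "\<lambda>n. z + inverse (real (Suc n)) *\<^sub>R (c - z)"]) simp
qed

lemma op_domain_diff_normal_cone: "op_domain (op_diff A (normal_cone K)) = op_domain A \<inter> K"
proof -
  have "op_diff A (normal_cone K) z \<noteq> {} \<longleftrightarrow> A z \<noteq> {} \<and> normal_cone K z \<noteq> {}" for z
    unfolding op_diff_def by blast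
  moreover have "0 \<in> normal_cone K z" if "z \<in> K" for z using that by (simp add: normal_cone_iff)
  then have "normal_cone K z \<noteq> {} \<longleftrightarrow> z \<in> K" for z by (metis empty_iff normal_cone_def)
  ultimately show ?thesis unfolding op_domain_def by blast
qed

lemma maximal_dissipative_diff_normal_cone:
  fixes A :: "'a::{real_inner, complete_space} \<Rightarrow> 'a set"
  assumes "maximal_dissipative A" "closed K" "convex K" and z: "z \<in> op_domain A" "z \<in> interior K"
  shows "maximal_dissipative (op_diff A (normal_cone K))"
proof -
  interpret A: maximal_monotone_op "\<lambda>w. uminus ` A w"
    using assms(1) by unfold_locales (simp add: maximal_dissipative_def)
  have "uminus ` op_diff A (normal_cone K) w = {a + b |a b. a \<in> uminus ` A w \<and> b \<in> normal_cone K w}" for w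
    by (auto simp: op_diff_def image_iff) (metis minus_diff_eq uminus_add_conv_diff)+
  moreover have "z \<in> op_domain (\<lambda>w. uminus ` A w)" using z(1) by (simp add: op_domain_def)
  ultimately show ?thesis
    using A.maximal_monotone_add_normal_cone[OF assms(2,3) _ z(2)] by (simp add: maximal_dissipative_def)
qed

text \<open>
  Both right derivatives lie in the dissipative operator \<open>op_diff A (normal_cone K)\<close>, so the distance of two
  solutions cannot grow.
\<close>

lemma pdi_solution_unique:
  fixes K :: "'a::{real_inner, complete_space} set"
  assumes "convex K" and diss: "maximal_dissipative (op_diff A (normal_cone K))"
    and y: "pdi_solution A K z0 y" and z: "pdi_solution A K z0 z" and t: "0 \<le> t"
  shows "y t = z t"
proof (rule dissipative_solutions_coincide[OF _ _ _ _ t])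
  show "continuous_on {0..} y" "continuous_on {0..} z" "y 0 = z 0"
    using y z by (auto simp: pdi_solution_def intro: lipschitz_on_continuous_on)
  fix s :: real assume "0 \<le> s"
  then obtain p q where pq: "p \<in> cone_projection K (y s) (A (y s))" "(y has_vector_derivative p) (at_right s)"
    "q \<in> cone_projection K (z s) (A (z s))" "(z has_vector_derivative q) (at_right s)"
    using y z unfolding pdi_solution_def by meson
  have "p \<in> op_diff A (normal_cone K) (y s)" "q \<in> op_diff A (normal_cone K) (z s)"
    using pq cone_projection_subset_diff_normal_cone[OF assms(1)] by blast+
  then have "0 \<le> inner (- p - (- q)) (y s - z s)"
    using diss unfolding maximal_dissipative_def maximal_monotone_def monotone_operator_iff by blast
  then have "inner (p - q) (y s - z s) \<le> 0" by (simp add: inner_simps)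
  with pq show "\<exists>p q. (y has_vector_derivative p) (at_right s) \<and>
      (z has_vector_derivative q) (at_right s) \<and> inner (p - q) (y s - z s) \<le> 0" by blast
qed

text \<open>
  The domain of \<open>A\<close> is dense in the interior of \<open>K\<close>, which supplies the point needed for maximality of
  the sum and shows that the closure of the domain of the sum is \<open>K\<close>. The rest is the
  semigroup theory applied to the monotone operator \<open>- (A - N)\<close>, whose minimal section is the negative of
  \<open>minimal_projected A K\<close> by \<open>min_norm_element_cone_projection\<close>.
\<close>

theorem theorem3p3:
  fixes A :: "'a::{real_inner, complete_space} \<Rightarrow> 'a set" and K :: "'a set"
  assumes "maximal_dissipative A"
    and "closed K" and "convex K" and "interior K \<noteq> {}"
    and "K \<subseteq> closure (op_domain A)"
  shows
    "(\<forall>z\<in>op_domain A \<inter> K.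
        is_min_norm_element (cone_projection K z (A z)) (minimal_projected A K z)) \<and>
     op_domain (op_diff A (normal_cone K)) = op_domain A \<inter> K \<and>
     maximal_dissipative (op_diff A (normal_cone K)) \<and>
     (\<forall>z\<in>op_domain A \<inter> K.
        is_min_norm_element (op_diff A (normal_cone K) z) (minimal_projected A K z)) \<and>
     (\<exists>T. contraction_semigroup_on K T \<and>
        is_strong_generator K T (op_domain A \<inter> K) (minimal_projected A K) \<and>
        (\<forall>z0\<in>op_domain A \<inter> K.
           (\<exists>L. L-lipschitz_on {0..} (\<lambda>t. T t z0)) \<and>
           (\<forall>t\<ge>0. T t z0 \<in> op_domain A \<inter> K \<and>
              ((\<lambda>s. T s z0) has_vector_derivative minimal_projected A K (T t z0)) (at_right t) \<and>
              continuous (at_right t) (\<lambda>s. minimal_projected A K (T s z0)))) \<and>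
        (\<forall>z0\<in>op_domain A \<inter> K.
           pdi_solution A K z0 (\<lambda>t. T t z0) \<and>
           (\<forall>y. pdi_solution A K z0 y \<longrightarrow> (\<forall>t\<ge>0. y t = T t z0))))"
proof -
  let ?D = "op_domain A \<inter> K" and ?B = "op_diff A (normal_cone K)"
  have dense: "closure (interior K \<inter> op_domain A) = closure (interior K)"
    using assms(5) interior_subset by (intro closure_open_Int_superset) auto
  with assms(4) have "interior K \<inter> op_domain A \<noteq> {}" by (metis closure_eq_empty)
  then have diss: "maximal_dissipative ?B"
    using maximal_dissipative_diff_normal_cone[OF assms(1-3)] by blast
  interpret B: maximal_monotone_op "\<lambda>w. uminus ` ?B w"
    using diss by unfold_locales (simp add: maximal_dissipative_def)
  have dom: "op_domain (\<lambda>w. uminus ` ?B w) = ?D"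
    using op_domain_diff_normal_cone[of A K] by (simp add: op_domain_def)
  have clo: "closure ?D = K"
  proof
    show "closure ?D \<subseteq> K" by (intro closure_minimal assms(2)) auto
    have "K \<subseteq> closure (interior K \<inter> op_domain A)"
      unfolding dense by (rule closure_interior_convex[OF assms(3,4)])
    also have "\<dots> \<subseteq> closure ?D" using interior_subset by (intro closure_mono) auto
    finally show "K \<subseteq> closure ?D" .
  qed
  have minB: "is_min_norm_element (?B z) (- B.min_section z)" if "z \<in> ?D" for z
    using B.min_section_is_min[of z] that unfolding dom is_min_norm_element_def by fastforce
  have eq: "minimal_projected A K z = - B.min_section z" if "z \<in> ?D" for z
    unfolding minimal_projected_def
    by (intro arg_min_norm_eq min_norm_element_cone_projection assms minB that)
  define T where "T = B.semigroup"
  have TD: "T t z \<in> ?D" if "0 \<le> t" "z \<in> ?D" for t z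
    using B.semigroup_domain[of t z] that unfolding dom T_def by blast
  have semi: "contraction_semigroup_on K T"
    unfolding contraction_semigroup_on_def T_def
    using B.semigroup_closure B.semigroup_zero B.semigroup_add B.semigroup_continuous B.semigroup_nonexpansive
    unfolding dom clo by blast
  have gen: "is_strong_generator K T ?D (minimal_projected A K)"
    unfolding is_strong_generator_def
  proof (intro conjI ballI set_eqI iffI)
    fix z assume z: "z \<in> ?D"
    show "((\<lambda>t. (1 / t) *\<^sub>R (T t z - z)) \<longlongrightarrow> minimal_projected A K z) (at_right 0)"
      unfolding eq[OF z] T_def using z by (intro B.semigroup_right_derivative_zero) (simp only: dom)
    then show "z \<in> {z \<in> K. \<exists>w. ((\<lambda>t. (1 / t) *\<^sub>R (T t z - z)) \<longlongrightarrow> w) (at_right 0)}" using z by blast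
  next
    fix z assume "z \<in> {z \<in> K. \<exists>w. ((\<lambda>t. (1 / t) *\<^sub>R (T t z - z)) \<longlongrightarrow> w) (at_right 0)}"
    then show "z \<in> ?D"
      using B.semigroup_differentiable_imp_domain[of z] unfolding dom clo T_def by blast
  qed
  have lip: "\<exists>L. L-lipschitz_on {0..} (\<lambda>t. T t z)" if z: "z \<in> ?D" for z
  proof (intro exI lipschitz_onI)
    show "dist (T t z) (T s z) \<le> norm (B.min_section z) * dist t s" if "t \<in> {0..}" "s \<in> {0..}" for t s
      using that z unfolding dist_norm T_def real_norm_def
      by (intro B.semigroup_lipschitz B.sublevel_min_section) (auto simp only: dom atLeast_iff)
  qed simp
  have der: "((\<lambda>s. T s z) has_vector_derivative minimal_projected A K (T t z)) (at_right t)"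
    if "0 \<le> t" "z \<in> ?D" for t z
    unfolding eq[OF TD[OF that]] unfolding T_def
    using that by (intro B.semigroup_right_derivative) (simp_all only: dom)
  have cont: "continuous (at_right t) (\<lambda>s. minimal_projected A K (T s z))" if t: "0 \<le> t" and z: "z \<in> ?D" for t z
  proof -
    have "continuous (at_right t) (\<lambda>s. - B.min_section (T s z))"
      unfolding T_def using that by (intro continuous_minus B.min_section_right_continuous) (simp_all only: dom)
    then have "((\<lambda>s. - B.min_section (T s z)) \<longlongrightarrow> minimal_projected A K (T t z)) (at_right t)"
      unfolding continuous_within eq[OF TD[OF that]] .
    moreover have "\<forall>\<^sub>F s in at_right t. - B.min_section (T s z) = minimal_projected A K (T s z)"
      using eventually_at_right_less[of t]
    proof eventually_elim
      case (elim s)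
      then have "T s z \<in> ?D" using t by (intro TD z) simp
      then show ?case by (rule eq[symmetric])
    qed
    ultimately show ?thesis unfolding continuous_within by (rule Lim_transform_eventually)
  qed
  have min_cone: "is_min_norm_element (cone_projection K z (A z)) (minimal_projected A K z)" if "z \<in> ?D" for z
    unfolding eq[OF that] by (intro min_norm_element_cone_projection assms minB that)
  have sol: "pdi_solution A K z (\<lambda>t. T t z)" if z: "z \<in> ?D" for z
    unfolding pdi_solution_def
  proof (intro conjI allI impI lip[OF z] TD[OF _ z])
    show "T 0 z = z" by (simp add: T_def B.semigroup_zero)
    fix t :: real assume t: "0 \<le> t"
    have "minimal_projected A K (T t z) \<in> cone_projection K (T t z) (A (T t z))"
      using min_cone[OF TD[OF t z]] by (simp add: is_min_norm_element_def)
    with der[OF t z] show "\<exists>d\<in>cone_projection K (T t z) (A (T t z)). ((\<lambda>t. T t z) has_vector_derivative d) (at_right t)"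
      by blast
  qed
  have uniq: "y t = T t z" if "pdi_solution A K z y" "z \<in> ?D" "0 \<le> t" for y z t
    by (rule pdi_solution_unique[OF assms(3) diss that(1) sol[OF that(2)] that(3)])
  have minD: "is_min_norm_element (?B z) (minimal_projected A K z)" if "z \<in> ?D" for z
    unfolding eq[OF that] by (rule minB[OF that])
  show ?thesis
    using min_cone op_domain_diff_normal_cone diss minD
    by (intro conjI exI[of _ T] ballI allI impI semi gen lip TD der cont sol uniq) auto
qed

end
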